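(* For any integer $n\ge 2$ and any real numbers $\lambda,\mu$ with $\frac{1}{n}<\lambda<\frac{1}{n-1}$ and $\mu<0$, there exists a unique function $r(y)\in C^2(\mu,+\infty)\cap C([\mu,+\infty))$ which is a solution of $$\left\{\begin{aligned} &\frac{r_{yy}(y)}{1+r_y(y)^2}=\frac{n-1}{r(y)}-\frac{1+r_y(y)^2}{\lambda\,(r(y)-yr_y(y))},\quad r(y)>0,\quad\text{ for all } y\in(\mu,+\infty),\\ &r(\mu)=0,\qquad r_y(\mu)=\lim_{y\searrow\mu}r_y(y)=+\infty, \end{aligned}\right.$$ and which satisfies $$r(y)-yr_y(y)>0\quad\text{for all } y>\mu.$$
   Context: Here $r$ is a real-valued function of the real variable $y$, $r_y=\frac{dr}{dy}$ and $r_{yy}=\frac{d^2r}{dy^2}$. The condition $r_y(\mu)=\lim_{y\searrow\mu}r_y(y)=+\infty$ means that the right limit of $r_y(y)$ as $y\to\mu^+$ is $+\infty$. *)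

theory Defs
  imports "HOL-Analysis.Analysis"
begin

text \<open>Meant for open \<open>S\<close>: all derivatives are two-sided.\<close>

definition C2_on :: "(real \<Rightarrow> real) \<Rightarrow> real set \<Rightarrow> bool" where
  "C2_on r S \<longleftrightarrow>
     (\<forall>y\<in>S. r differentiable (at y)) \<and>
     (\<forall>y\<in>S. deriv r differentiable (at y)) \<and>
     continuous_on S (deriv (deriv r))"

text \<open>
  Functions on \<open>[\<mu>, \<infinity>)\<close> are represented by total functions whose values
  below \<open>\<mu>\<close> play no role in this predicate (uniqueness statements normalise them with
  \<^const>\<open>extensional\<close>): on the open set \<open>{\<mu><..}\<close>, \<open>deriv\<close> is the ordinary
  two-sided derivative, and the boundary conditions involve only the values at and above \<open>\<mu>\<close>.
  The quantity \<open>r y - y * deriv r y\<close> in the denominator is not required to be nonzero here;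
  its positivity has to be imposed alongside.
\<close>

definition profile_solution :: "nat \<Rightarrow> real \<Rightarrow> real \<Rightarrow> (real \<Rightarrow> real) \<Rightarrow> bool" where
  "profile_solution n lam \<mu> r \<longleftrightarrow>
     (\<forall>y>\<mu>. deriv (deriv r) y / (1 + (deriv r y)\<^sup>2)
              = (real n - 1) / r y - (1 + (deriv r y)\<^sup>2) / (lam * (r y - y * deriv r y))
            \<and> r y > 0) \<and>
     r \<mu> = 0 \<and>
     filterlim (deriv r) at_top (at_right \<mu>)"

end

theory Submission
  imports Defs
begin

text \<open>The equation is invariant under the scaling \<open>r(y) \<mapsto> c r(y / c)\<close>. The cotangent \<open>u = y / r\<close> of the
  polar angle is scale invariant and, because of \<open>r - y r' > 0\<close>, strictly increasing along a profile.
  As a function of \<open>u\<close> the slope \<open>p = r'\<close> satisfies a first-order equation,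
  \<open>dp/du = A (m - A / lam)\<close> with \<open>A = (1 + p\<^sup>2) / (1 - u p)\<close> and \<open>m = n - 1\<close>, from which \<open>r\<close> is
  recovered by a quadrature and one scaling constant. The point \<open>y = \<mu>\<close>, where \<open>r = 0\<close> and
  \<open>r' = \<infinity>\<close>, becomes the end \<open>u = -\<infinity>\<close> with \<open>p \<rightarrow> \<infinity>\<close>. The theorem therefore splits into two
  statements: exactly one solution \<open>p\<close> tends to \<open>\<infinity>\<close> at \<open>-\<infinity>\<close>, and it exists for all \<open>u\<close> and is such
  that \<open>y\<close> reaches \<open>\<infinity>\<close>.

  Existence. The line \<open>p = - u\<close> of the circles is a lower barrier since \<open>lam > 1 / n\<close>, and an explicit
  curve (\<open>roof\<close>) is an upper one that keeps \<open>u p < 1\<close>. Solutions started on the lower barrier at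
  \<open>u = - N\<close> increase with \<open>N\<close> and are trapped between the barriers, so they converge to a solution on
  the whole line (\<open>slope_exists\<close>). For \<open>u \<rightarrow> \<infinity>\<close>, \<open>- u p\<close> stays bounded (\<open>slope_decay\<close>), which makes
  \<open>y\<close> unbounded; for \<open>u \<rightarrow> -\<infinity>\<close>, \<open>y\<close> converges to a negative limit, which a scaling moves to \<open>\<mu>\<close>.

  Uniqueness. At \<open>u = -\<infinity>\<close> the ratio \<open>g = p / |u|\<close> obeys asymptotically
  \<open>|u| dg/d|u| = g (g - n lam) / lam\<close>, for which \<open>n lam > 1\<close> is repelling: a solution below \<open>p = |u|\<close>
  cannot tend to infinity (\<open>no_slow_escape\<close>), one above \<open>p = n lam |u| + 1\<close> blows up before reaching
  \<open>-\<infinity>\<close> (\<open>slope_below_line\<close>), and two solutions in between separate faster than linearly unless they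
  coincide (\<open>escaping_slopes_agree\<close>). The same decay lemma \<open>no_slow_escape\<close>, reflected by
  \<open>(u, p) \<mapsto> (- u, - p)\<close>, also controls the solution at \<open>u = \<infinity>\<close>.\<close>

section \<open>Scalar ordinary differential equations\<close>

text \<open>Picard's theorem on a whole compact interval. The integral operator is made a contraction by
  working with \<open>h t = exp (- 2 * L * t) * x t\<close>: in this weight its Lipschitz constant is
  \<open>1/2\<close>, whatever the length of the interval, so a single contraction covers all of it.\<close>

lemma ode_solution_exists:
  fixes f :: "real \<Rightarrow> real \<Rightarrow> real"
  assumes ab: "a \<le> b" and L: "L > 0"
    and cont: "\<And>g. continuous_on {a..b} g \<Longrightarrow> continuous_on {a..b} (\<lambda>t. f t (g t))"
    and lip: "\<And>t x y. t \<in> {a..b} \<Longrightarrow> \<bar>f t x - f t y\<bar> \<le> L * \<bar>x - y\<bar>"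
  obtains x where "x a = x0"
    and "\<And>t. t \<in> {a..b} \<Longrightarrow> (x has_real_derivative f t (x t)) (at t within {a..b})"
proof -
  define G :: "(real \<Rightarrow>\<^sub>C real) \<Rightarrow> real \<Rightarrow> real"
    where "G h s = f s (exp (2 * L * s) * h s)" for h s
  define \<Phi> :: "(real \<Rightarrow>\<^sub>C real) \<Rightarrow> real \<Rightarrow> real"
    where "\<Phi> h t = exp (- 2 * L * t) * (x0 + integral {a..t} (G h))" for h t
  have contG: "continuous_on {a..b} (G h)" for h
    unfolding G_def by (intro cont continuous_intros) auto
  have intG: "G h integrable_on {a..t}" if "t \<in> {a..b}" for h t
    by (rule integrable_continuous_real, rule continuous_on_subset[OF contG]) (use that in auto)
  have cont\<Phi>: "continuous_on {a..b} (\<Phi> h)" for h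
    unfolding \<Phi>_def
    by (intro continuous_intros indefinite_integral_continuous_1 intG) (use ab in auto)
  have "\<exists>g :: real \<Rightarrow>\<^sub>C real. \<forall>t. g t = \<Phi> h (clamp a b t)" for h
    using continuous_on_cbox_bcontfunE[of a b "\<Phi> h"] cont\<Phi>[of h] by (metis box_real(2))
  then obtain T :: "(real \<Rightarrow>\<^sub>C real) \<Rightarrow> (real \<Rightarrow>\<^sub>C real)"
    where T: "\<And>h t. T h t = \<Phi> h (clamp a b t)" by metis
  \<comment> \<open>The factor \<open>exp (2 * L * s)\<close> of the weight integrates to at most
    \<open>exp (2 * L * t) / (2 * L)\<close>, which cancels both the weight at \<open>t\<close> and the constant \<open>L\<close>.\<close>
  have est: "\<bar>\<Phi> h t - \<Phi> k t\<bar> \<le> 1/2 * dist h k" if t: "t \<in> {a..b}" for h k t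
  proof -
    define d where "d = dist h k"
    have d: "d \<ge> 0" by (simp add: d_def)
    have 1: "\<bar>G h s - G k s\<bar> \<le> L * (exp (2 * L * s) * d)" if "s \<in> {a..t}" for s
    proof -
      have "\<bar>G h s - G k s\<bar> \<le> L * \<bar>exp (2 * L * s) * h s - exp (2 * L * s) * k s\<bar>"
        unfolding G_def by (rule lip) (use that t in auto)
      also have "\<dots> = L * (exp (2 * L * s) * \<bar>h s - k s\<bar>)"
        by (simp add: right_diff_distrib[symmetric] abs_mult)
      also have "\<dots> \<le> L * (exp (2 * L * s) * d)"
        using dist_bounded[of h s k] L by (simp add: d_def dist_real_def)
      finally show ?thesis .
    qed
    have hi: "((\<lambda>s. L * (exp (2 * L * s) * d)) has_integral
        exp (2 * L * t) * d / 2 - exp (2 * L * a) * d / 2) {a..t}"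
      using t L by (intro fundamental_theorem_of_calculus)
        (auto intro!: derivative_eq_intros simp flip: has_real_derivative_iff_has_vector_derivative)
    have "\<bar>integral {a..t} (G h) - integral {a..t} (G k)\<bar>
        = norm (integral {a..t} (\<lambda>s. G h s - G k s))"
      using integral_diff[OF intG[OF t] intG[OF t], of h k] by simp
    also have "\<dots> \<le> integral {a..t} (\<lambda>s. L * (exp (2 * L * s) * d))"
      using hi 1 t by (intro integral_norm_bound_integral integrable_diff intG) auto
    also have "\<dots> = exp (2 * L * t) * d / 2 - exp (2 * L * a) * d / 2"
      using hi by (rule integral_unique)
    also have "\<dots> \<le> exp (2 * L * t) * d / 2" using d by simp
    finally have 2: "\<bar>integral {a..t} (G h) - integral {a..t} (G k)\<bar> \<le> exp (2 * L * t) * d / 2" .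
    have "\<bar>\<Phi> h t - \<Phi> k t\<bar>
        = exp (- 2 * L * t) * \<bar>integral {a..t} (G h) - integral {a..t} (G k)\<bar>"
      unfolding \<Phi>_def by (simp add: right_diff_distrib[symmetric] abs_mult)
    also have "\<dots> \<le> exp (- 2 * L * t) * (exp (2 * L * t) * d / 2)"
      by (rule mult_left_mono[OF 2]) auto
    also have "\<dots> = d / 2" by (simp add: exp_minus)
    finally show ?thesis by (simp add: d_def)
  qed
  have "\<exists>!h. T h = h"
  proof (rule banach_fix_type)
    have cl: "clamp a b t \<in> {a..b}" for t
      using clamp_in_interval[of a b t] ab by (simp add: box_real)
    show "\<forall>h k. dist (T h) (T k) \<le> 1/2 * dist h k"
    proof (intro allI dist_bound)
      fix h k t
      show "dist (T h t) (T k t) \<le> 1/2 * dist h k"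
        unfolding T dist_real_def by (rule est[OF cl])
    qed
  qed auto
  then obtain h where h: "T h = h" by blast
  have fix': "exp (2 * L * t) * h t = x0 + integral {a..t} (G h)" if "t \<in> {a..b}" for t
  proof -
    have "h t = \<Phi> h t"
      using T[of h t] h that clamp_cancel_cbox[of t a b] by (simp add: box_real)
    then show ?thesis by (simp add: \<Phi>_def exp_minus)
  qed
  show thesis
  proof (rule that[of "\<lambda>t. x0 + integral {a..t} (G h)"])
    show "x0 + integral {a..a} (G h) = x0" by simp
    fix t assume t: "t \<in> {a..b}"
    have "((\<lambda>t. x0 + integral {a..t} (G h)) has_real_derivative G h t) (at t within {a..b})"
      using integral_has_real_derivative[OF contG t]
      by (auto intro!: derivative_eq_intros)
    then show "((\<lambda>t. x0 + integral {a..t} (G h)) has_real_derivative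
        f t (x0 + integral {a..t} (G h))) (at t within {a..b})"
      using fix'[OF t] by (simp add: G_def)
  qed
qed

text \<open>The only comparison principle used below: if \<open>d\<close> increases strictly at each of its zeros, then it
  cannot become negative, since at the last time before with \<open>d \<ge> 0\<close> it would vanish and increase.
  It is applied to the gap between a solution and an explicit curve that the solution can cross in
  one direction only.\<close>

lemma barrier:
  fixes d d' :: "real \<Rightarrow> real"
  assumes der: "\<And>t. t \<in> {a..b} \<Longrightarrow> (d has_real_derivative d' t) (at t within {a..b})"
    and a: "d a \<ge> 0"
    and out: "\<And>t. t \<in> {a..b} \<Longrightarrow> d t = 0 \<Longrightarrow> d' t > 0"
    and t: "t \<in> {a..b}"
  shows "d t \<ge> 0"
proof (rule ccontr)
  assume neg: "\<not> d t \<ge> 0"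
  define S where "S = {s \<in> {a..t}. d s \<ge> 0}"
  have cd: "continuous_on {a..t} d"
    using der t by (intro continuous_on_subset[OF DERIV_continuous_on[of "{a..b}"]]) auto
  have "S = {a..t} \<inter> d -` {0..}" by (auto simp: S_def)
  then have "closed S" using continuous_closed_preimage[OF cd, of "{0..}"] by simp
  moreover have "a \<in> S" using a t by (auto simp: S_def)
  moreover have "bdd_above S" by (auto simp: S_def bdd_above_def)
  ultimately have sS: "Sup S \<in> S" and ub: "\<And>s. s \<in> S \<Longrightarrow> s \<le> Sup S"
    using closed_contains_Sup[of S] cSup_upper[of _ S] by blast+
  define s where "s = Sup S"
  have s: "a \<le> s" "s \<le> t" "d s \<ge> 0" using sS unfolding s_def[symmetric] by (auto simp: S_def)
  then have st: "s < t" using neg by (cases "s = t") auto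
  have zero: "d s = 0"
  proof (rule ccontr)
    assume "d s \<noteq> 0"
    then have "d s > 0" using s by simp
    then obtain z where z: "s \<le> z" "z \<le> t" "d z = 0"
      using IVT2'[of d t 0 s] neg s cd continuous_on_subset[OF cd, of "{s..t}"] by auto
    then have "z \<in> S" using s by (auto simp: S_def)
    then have "z = s" using ub[of z] z by (simp add: s_def)
    then show False using z \<open>d s > 0\<close> by simp
  qed
  have "s \<in> {a..b}" using s t by auto
  from has_real_derivative_pos_inc_right[OF der[OF this] out[OF this zero]]
  obtain e where e: "e > 0" "\<And>h. 0 < h \<Longrightarrow> s + h \<in> {a..b} \<Longrightarrow> h < e \<Longrightarrow> d s < d (s + h)" by blast
  define h where "h = min (e/2) (t - s)"
  have "0 < h" "h < e" "s + h \<le> t" using e(1) st by (auto simp: h_def)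
  then have "d (s + h) > 0" "s + h \<in> {a..t}" using e(2)[of h] s t zero by auto
  then have "s + h \<le> s" using ub[of "s+h"] by (auto simp: S_def s_def)
  then show False using \<open>0 < h\<close> by simp
qed

text \<open>Two solutions of one scalar equation have a difference \<open>D\<close> with \<open>D' = H D\<close>, where \<open>H\<close> is a divided
  difference of the right-hand side. The formula shows that they stay ordered, and that they
  coincide if they meet.\<close>

lemma linear_ode:
  fixes D H :: "real \<Rightarrow> real"
  assumes der: "\<And>t. t \<in> {a..b} \<Longrightarrow> (D has_real_derivative H t * D t) (at t within {a..b})"
    and H: "continuous_on {a..b} H" and t: "t \<in> {a..b}"
  shows "D t = D a * exp (integral {a..t} H)"
proof -
  define E where "E t = D t * exp (- integral {a..t} H)" for t
  have "(E has_field_derivative 0) (at s within {a..b})" if "s \<in> {a..b}" for s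
    unfolding E_def
    by (rule derivative_eq_intros der[OF that] integral_has_real_derivative[OF H that] refl)+
       (auto simp: algebra_simps)
  then obtain c where c: "\<And>s. s \<in> {a..b} \<Longrightarrow> E s = c"
    using has_field_derivative_zero_constant[of "{a..b}" E] by auto
  have "E t = E a" using c[OF t] c[of a] t by auto
  then show ?thesis by (simp add: E_def exp_minus field_simps)
qed

lemma linear_ode_zero:
  fixes D H :: "real \<Rightarrow> real"
  assumes "\<And>t. t \<in> {a..b} \<Longrightarrow> (D has_real_derivative H t * D t) (at t within {a..b})"
    and "continuous_on {a..b} H" and "s \<in> {a..b}" "D s = 0" and "t \<in> {a..b}"
  shows "D t = 0"
  using linear_ode[OF assms(1,2), of s] linear_ode[OF assms(1,2), of t] assms(3-) by auto

text \<open>Both changes of variables, from \<open>y\<close> to \<open>u = y / r\<close> in a given profile and back in the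
  construction of one, rest on this form of the inverse function theorem.\<close>

lemma increasing_inverse:
  fixes f f' :: "real \<Rightarrow> real"
  assumes S: "open S" "is_interval S"
    and der: "\<And>x. x \<in> S \<Longrightarrow> (f has_real_derivative f' x) (at x)"
    and pos: "\<And>x. x \<in> S \<Longrightarrow> f' x > 0"
  obtains g where "\<And>x. x \<in> S \<Longrightarrow> g (f x) = x"
    and "\<And>x. x \<in> S \<Longrightarrow> (g has_real_derivative inverse (f' x)) (at (f x))"
    and "open (f ` S)" "is_interval (f ` S)" "strict_mono_on S f"
proof -
  have mono: "strict_mono_on S f"
  proof (rule strict_mono_onI)
    fix x y assume xy: "x \<in> S" "y \<in> S" "x < y"
    have "z \<in> S" if "x \<le> z" "z \<le> y" for z
      using S(2) xy that unfolding is_interval_1 by blast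
    then have "\<exists>D. (f has_real_derivative D) (at z) \<and> D > 0" if "x \<le> z" "z \<le> y" for z
      using der[of z] pos[of z] that by auto
    then show "f x < f y" by (intro DERIV_pos_imp_increasing[OF xy(3)])
  qed
  have inj: "inj_on f S" using mono by (rule strict_mono_on_imp_inj_on)
  have cont: "continuous_on S f" by (rule DERIV_continuous_on[OF has_field_derivative_at_within[OF der]])
  have "open (f ` S)" using S(1) cont inj by (rule injective_into_1d_imp_open_map_UNIV) simp
  moreover have "is_interval (f ` S)"
    using connected_continuous_image[OF cont] S(2) by (simp add: is_interval_connected_1)
  moreover have "(the_inv_into S f has_real_derivative inverse (f' x)) (at (f x))" if "x \<in> S" for x
    unfolding has_field_derivative_def
    by (rule has_derivative_inverse_strong[OF S(1) that cont _ der[OF that, unfolded has_field_derivative_def]])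
       (use pos[OF that] inj in \<open>auto simp: the_inv_into_f_f fun_eq_iff\<close>)
  ultimately show thesis using that[of "the_inv_into S f"] mono inj by (simp add: the_inv_into_f_f)
qed

section \<open>The slope field\<close>

text \<open>Here \<open>m\<close> stands for \<open>n - 1\<close>. The combination \<open>(m + 1) * lam\<close>, which lies strictly between \<open>1\<close>
  and \<open>2\<close>, is the growth rate of the slope at \<open>u = -\<infinity>\<close>.\<close>

locale expander =
  fixes m lam :: real
  assumes m: "m \<ge> 1" and lam_lower: "1 / (m + 1) < lam" and lam_upper: "lam < 1 / m"
begin

lemma lam_bounds: "0 < lam" "lam < 1" "m * lam < 1" "1 < (m + 1) * lam" "(m + 1) * lam < 2"
proof -
  show pos: "0 < lam" using lam_lower m by (smt (verit) divide_pos_pos)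
  show a: "m * lam < 1" using lam_upper m by (simp add: field_simps)
  show "1 < (m + 1) * lam" using lam_lower m by (simp add: field_simps)
  show b: "lam < 1" using a m pos by (smt (verit) mult_le_cancel_right1)
  show "(m + 1) * lam < 2" using a b by (simp add: algebra_simps)
qed

text \<open>Along a profile, with \<open>p\<close> the slope and \<open>u = y / r\<close>, this is \<open>r (1 + p\<^sup>2) / (r - y p)\<close>: up to the
  factor \<open>lam\<close>, the quotient of the two competing terms \<open>(1 + p\<^sup>2) / (lam (r - y p))\<close> and \<open>1 / r\<close>
  in the equation. Its denominator \<open>1 - u p\<close> is positive exactly when \<open>r - y p > 0\<close>.\<close>

definition bend :: "real \<Rightarrow> real \<Rightarrow> real" where
  "bend u p = (1 + p\<^sup>2) / (1 - u * p)"

text \<open>Since \<open>du/dy = (1 - u p) / r\<close>, the second-order equation for \<open>r\<close> turns into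
  \<open>dp/du = slope_field u p\<close>, in which \<open>r\<close> itself has disappeared by scale invariance.\<close>

definition slope_field :: "real \<Rightarrow> real \<Rightarrow> real" where
  "slope_field u p = bend u p * (m - bend u p / lam)"

lemma bend_pos: "u * p < 1 \<Longrightarrow> bend u p > 0"
  by (simp add: bend_def add_pos_nonneg)

lemma bend_reflect: "bend (- u) (- p) = bend u p"
  by (simp add: bend_def)

text \<open>The reflection \<open>y \<mapsto> - y\<close> of a profile. It lets the ends \<open>u = -\<infinity>\<close> and \<open>u = \<infinity>\<close> share one
  decay lemma.\<close>

lemma slope_field_reflect: "slope_field (- u) (- p) = slope_field u p"
  by (simp add: slope_field_def bend_reflect)

text \<open>The lines \<open>p = - ((m + 1) * lam) * u + const\<close> have slope \<open>- ((m + 1) * lam)\<close>, so on which side a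
  solution crosses them is decided by the sign of \<open>bend u p - (m + 1) * lam\<close>.\<close>

lemma slope_field_factor:
  "slope_field u p = - ((m + 1) * lam) - (bend u p - (m + 1) * lam) * (bend u p + lam) / lam"
  using lam_bounds by (simp add: slope_field_def field_simps)

text \<open>The divided difference of \<open>slope_field u\<close> between \<open>p\<close> and \<open>q\<close>, in a form that makes sense and is
  continuous also for \<open>p = q\<close>.\<close>

definition slope_quotient :: "real \<Rightarrow> real \<Rightarrow> real \<Rightarrow> real" where
  "slope_quotient u p q = (p + q + u - u * p * q) / ((1 - u * p) * (1 - u * q))
                * (m - (bend u p + bend u q) / lam)"

lemma bend_diff:
  assumes "u * p \<noteq> 1" "u * q \<noteq> 1"
  shows "bend u p - bend u q = (p - q) * ((p + q + u - u * p * q) / ((1 - u * p) * (1 - u * q)))"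
proof -
  have "bend u p - bend u q
      = ((1 + p\<^sup>2) * (1 - u * q) - (1 + q\<^sup>2) * (1 - u * p)) / ((1 - u * p) * (1 - u * q))"
    using assms by (simp add: bend_def diff_frac_eq)
  also have "(1 + p\<^sup>2) * (1 - u * q) - (1 + q\<^sup>2) * (1 - u * p) = (p - q) * (p + q + u - u * p * q)"
    by algebra
  finally show ?thesis by simp
qed

lemma slope_field_diff:
  assumes "u * p \<noteq> 1" "u * q \<noteq> 1"
  shows "slope_field u p - slope_field u q = slope_quotient u p q * (p - q)"
proof -
  have "slope_field u p - slope_field u q
      = (bend u p - bend u q) * (m - (bend u p + bend u q) / lam)"
    using lam_bounds by (simp add: slope_field_def field_simps)
  then show ?thesis
    using bend_diff[OF assms] by (simp add: slope_quotient_def)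
qed

lemma slope_quotient_bound:
  assumes "\<bar>u\<bar> \<le> J" "\<bar>p\<bar> \<le> R" "\<bar>q\<bar> \<le> R" "1 - u * p \<ge> d" "1 - u * q \<ge> d" "d > 0"
  shows "\<bar>slope_quotient u p q\<bar> \<le> (2 * R + J + J * R * R) / (d * d) * (m + 2 * ((1 + R\<^sup>2) / d) / lam)"
proof -
  have R: "R \<ge> 0" and J: "J \<ge> 0" using assms by auto
  have bend: "0 < bend u r" "bend u r \<le> (1 + R\<^sup>2) / d" if "\<bar>r\<bar> \<le> R" "1 - u * r \<ge> d" for r
  proof -
    show "0 < bend u r" using that assms by (intro bend_pos) auto
    have "r\<^sup>2 \<le> R\<^sup>2" using that by (simp add: abs_le_square_iff[symmetric])
    then show "bend u r \<le> (1 + R\<^sup>2) / d"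
      unfolding bend_def using that assms by (intro frac_le) auto
  qed
  have 1: "\<bar>m - (bend u p + bend u q) / lam\<bar> \<le> m + 2 * ((1 + R\<^sup>2) / d) / lam"
  proof -
    have "0 \<le> (bend u p + bend u q) / lam" using bend assms lam_bounds by (simp add: less_imp_le)
    moreover have "(bend u p + bend u q) / lam \<le> 2 * ((1 + R\<^sup>2) / d) / lam"
      using add_mono[OF bend(2)[of p] bend(2)[of q]] assms lam_bounds
      by (intro divide_right_mono) auto
    ultimately show ?thesis using m by linarith
  qed
  have 2: "\<bar>u * p * q\<bar> \<le> J * R * R"
    unfolding abs_mult by (intro mult_mono) (use assms R J in auto)
  have "\<bar>(p + q + u - u * p * q) / ((1 - u * p) * (1 - u * q))\<bar>
      = \<bar>p + q + u - u * p * q\<bar> / ((1 - u * p) * (1 - u * q))"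
    using assms by (simp add: abs_mult)
  also have "\<dots> \<le> (2 * R + J + J * R * R) / (d * d)"
    using assms 2 by (intro frac_le mult_mono) auto
  finally show ?thesis
    unfolding slope_quotient_def abs_mult using 1 R J by (intro mult_mono) auto
qed

text \<open>The circle \<open>r\<^sup>2 + y\<^sup>2 = const\<close> corresponds to \<open>p = - u\<close>. There \<open>bend\<close> is \<open>1\<close>, and the field points
  above the line because \<open>lam > 1 / (m + 1)\<close>; for \<open>lam = 1 / (m + 1)\<close> the circle would be a
  solution.\<close>

lemma slope_field_lower: "slope_field u (- u) > - 1"
proof -
  have "1 + u * u \<noteq> 0" by (smt (verit) zero_le_square)
  then have "bend u (- u) = 1" by (simp add: bend_def power2_eq_square)
  then show ?thesis using lam_bounds by (simp add: slope_field_def field_simps)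
qed

text \<open>The upper barrier: \<open>1 - (m + 1) * lam * u\<close> for \<open>u \<le> 0\<close> and \<open>1 / (1 + u)\<close> for \<open>u \<ge> 0\<close>, written as
  a single visibly continuous expression. The second branch keeps \<open>u * p\<close> below \<open>1\<close>.\<close>

definition roof :: "real \<Rightarrow> real" where
  "roof u = 1 / (1 + max u 0) - (m + 1) * lam * min u 0"

text \<open>With \<open>k = (m + 1) * lam\<close>, the numerator of \<open>bend - k\<close> on this line is \<open>2 - k - k u\<close>, positive for
  \<open>u \<le> 0\<close> because \<open>k < 2\<close>. By \<open>slope_field_factor\<close> the field then points below the line.\<close>

lemma slope_field_roof_left:
  assumes "u \<le> 0"
  shows "slope_field u (1 - (m + 1) * lam * u) < - ((m + 1) * lam)"
proof -
  define k where "k = (m + 1) * lam"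
  have k: "1 < k" "k < 2" using lam_bounds by (auto simp: k_def)
  have ku: "k * u \<le> 0" using k assms by (simp add: mult_nonneg_nonpos)
  have "u * (1 - k * u) \<le> 0" using ku assms by (simp add: mult_nonpos_nonneg)
  then have z: "0 < 1 - u * (1 - k * u)" by simp
  have "k * (1 - u * (1 - k * u)) < 1 + (1 - k * u)\<^sup>2"
    using k ku by (simp add: power2_eq_square algebra_simps)
  then have "k < bend u (1 - k * u)" using z by (simp add: bend_def field_simps)
  then have "0 < (bend u (1 - k * u) - k) * (bend u (1 - k * u) + lam) / lam"
    using k lam_bounds by simp
  then show ?thesis using slope_field_factor[of u "1 - k * u"] by (simp add: k_def)
qed

text \<open>On this curve \<open>1 - u q = q\<close>, so \<open>bend = (1 + q\<^sup>2) / q \<ge> 2\<close>, and \<open>m lam < 1\<close> makes the field more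
  negative than \<open>- q\<^sup>2\<close>, the slope of the curve.\<close>

lemma slope_field_roof_right:
  assumes "u \<ge> 0"
  shows "slope_field u (1 / (1 + u)) < - ((1 / (1 + u))\<^sup>2)"
proof -
  define q where "q = 1 / (1 + u)"
  have q: "0 < q" "q \<le> 1" using assms by (auto simp: q_def)
  have "1 - u * q = q" using assms by (simp add: q_def field_simps)
  then have b: "bend u q = (1 + q\<^sup>2) / q" by (simp add: bend_def)
  have "2 * q \<le> 1 + q\<^sup>2" using sum_squares_bound[of 1 q] by simp
  then have 2: "bend u q \<ge> 2" using q by (simp add: b field_simps)
  have "bend u q / lam \<ge> bend u q" using 2 lam_bounds by (simp add: field_simps)
  moreover have "bend u q / lam - m = (bend u q - m * lam) / lam" using lam_bounds by (simp add: field_simps)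
  moreover have "\<dots> > 1" using 2 lam_bounds by (simp add: field_simps)
  ultimately have "bend u q * (bend u q / lam - m) > 2 * 1" using 2 by (intro mult_le_less_imp_less) auto
  moreover have "q\<^sup>2 \<le> 1" using q by (simp add: power_le_one)
  ultimately show ?thesis by (simp add: slope_field_def q_def[symmetric] algebra_simps)
qed

lemma floor_le_roof: "- u \<le> roof u"
proof (cases "u \<le> 0")
  case True
  then have "u * ((m + 1) * lam) \<le> u * 1" using lam_bounds by (intro mult_left_mono_neg) auto
  then show ?thesis using True by (simp add: roof_def max_def min_def mult.commute)
next
  case False
  then show ?thesis
    by (simp add: roof_def max_def min_def add_pos_pos less_imp_le order.trans[of "-u" 0])
qed

text \<open>Between the two barriers the denominator \<open>1 - u * p\<close> stays away from \<open>0\<close> and the slope is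
  bounded, locally uniformly in \<open>u\<close>.\<close>

lemma region:
  assumes "- u \<le> p" "p \<le> roof u" "\<bar>u\<bar> \<le> J"
  shows "1 - u * p \<ge> 1 / (1 + J)" "\<bar>p\<bar> \<le> 1 + 2 * J"
proof -
  have "1 - u * p \<ge> 1 / (1 + J) \<and> \<bar>p\<bar> \<le> 1 + 2 * J"
  proof (cases "u \<le> 0")
    case True
    then have "u * p \<le> 0" using assms by (simp add: mult_nonpos_nonneg)
    moreover have "1 / (1 + J) \<le> 1" using assms by simp
    ultimately have 1: "1 - u * p \<ge> 1 / (1 + J)" by linarith
    have "(m + 1) * lam * (- u) \<le> 2 * (- u)" using lam_bounds True by (intro mult_right_mono) auto
    then have "p \<le> 1 + 2 * J" using assms True by (simp add: roof_def max_def min_def split: if_splits)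
    then show ?thesis using 1 assms True by auto
  next
    case False
    then have u: "u > 0" by simp
    then have p: "p \<le> 1 / (1 + u)" using assms by (simp add: roof_def max_def min_def split: if_splits)
    then have "u * p \<le> u * (1 / (1 + u))" using u by (intro mult_left_mono) auto
    also have "\<dots> = 1 - 1 / (1 + u)" using u by (simp add: field_simps)
    finally have "1 - u * p \<ge> 1 / (1 + u)" by simp
    moreover have "1 / (1 + u) \<ge> 1 / (1 + J)" using u assms by (intro divide_left_mono) auto
    moreover have "1 / (1 + u) \<le> 1" using u by simp
    ultimately show ?thesis using assms p by linarith
  qed
  then show "1 - u * p \<ge> 1 / (1 + J)" "\<bar>p\<bar> \<le> 1 + 2 * J" by auto
qed

lemma region_strict:
  assumes "- u \<le> p" "p \<le> roof u" shows "u * p < 1"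
proof -
  have "1 / (1 + \<bar>u\<bar>) > 0" by simp
  then show ?thesis using region(1)[OF assms order_refl] by linarith
qed

lemma continuous_slope_field:
  assumes "continuous_on S g" "\<And>t. t \<in> S \<Longrightarrow> t * g t \<noteq> 1"
  shows "continuous_on S (\<lambda>t. slope_field t (g t))"
  unfolding slope_field_def bend_def using assms lam_bounds
  by (intro continuous_intros) auto

section \<open>A slope defined on the whole line\<close>

text \<open>The field is frozen outside the strip between \<open>- u\<close> and \<open>roof u\<close>, which makes it Lipschitz in \<open>p\<close>.
  The barriers then show that the solution of the modified equation never leaves the strip, so that
  it solves the original one. Starting on the lower barrier makes the family in \<open>N\<close> monotone.\<close>

lemma slope_on_interval:
  assumes N: "N \<ge> 0"
  obtains p where "p (- N) = N"
    and "\<And>t. t \<in> {- N..N} \<Longrightarrow> (p has_real_derivative slope_field t (p t)) (at t within {- N..N})"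
    and "\<And>t. t \<in> {- N..N} \<Longrightarrow> - t \<le> p t" and "\<And>t. t \<in> {- N..N} \<Longrightarrow> p t \<le> roof t"
proof -
  define cut where "cut t x = max (- t) (min (roof t) x)" for t x
  define f where "f t x = slope_field t (cut t x)" for t x
  define d where "d = 1 / (1 + N)"
  define R where "R = 1 + 2 * N"
  define L where "L = (2 * R + N + N * R * R) / (d * d) * (m + 2 * ((1 + R\<^sup>2) / d) / lam)"
  have d: "d > 0" and R: "R > 0" using N by (auto simp: d_def R_def)
  have "(2 * R + N + N * R * R) / (d * d) > 0"
    using d R N by (intro divide_pos_pos add_pos_nonneg) auto
  moreover have "m + 2 * ((1 + R\<^sup>2) / d) / lam > 0"
    using m d lam_bounds by (intro add_pos_nonneg divide_nonneg_pos mult_nonneg_nonneg) auto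
  ultimately have L: "L > 0" unfolding L_def by (rule mult_pos_pos)
  have cut: "- t \<le> cut t x" "cut t x \<le> roof t" for t x
    using floor_le_roof[of t] by (auto simp: cut_def)
  have cut1: "t * cut t x \<noteq> 1" for t x using region_strict[OF cut] by (metis less_irrefl)
  have contcut: "continuous_on {- N..N} (\<lambda>t. cut t (g t))" if "continuous_on {- N..N} g" for g
    unfolding cut_def roof_def using that by (intro continuous_intros) auto
  have lip: "\<bar>f t x - f t y\<bar> \<le> L * \<bar>x - y\<bar>" if t: "t \<in> {- N..N}" for t x y
  proof -
    have "\<bar>f t x - f t y\<bar> = \<bar>slope_quotient t (cut t x) (cut t y)\<bar> * \<bar>cut t x - cut t y\<bar>"
      by (simp add: f_def slope_field_diff cut1 abs_mult)
    also have "\<dots> \<le> L * \<bar>x - y\<bar>"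
    proof (rule mult_mono)
      have tN: "\<bar>t\<bar> \<le> N" using t by auto
      show "\<bar>slope_quotient t (cut t x) (cut t y)\<bar> \<le> L"
        unfolding L_def
        by (rule slope_quotient_bound) (use tN d region[OF cut(1) cut(2) tN] in \<open>auto simp: d_def R_def\<close>)
      show "\<bar>cut t x - cut t y\<bar> \<le> \<bar>x - y\<bar>" by (auto simp: cut_def max_def min_def)
    qed (use L in auto)
    finally show ?thesis .
  qed
  have cont: "continuous_on {- N..N} (\<lambda>t. f t (g t))" if "continuous_on {- N..N} g" for g
    unfolding f_def by (intro continuous_slope_field contcut that cut1)
  obtain p where p0: "p (- N) = N"
    and p: "\<And>t. t \<in> {- N..N} \<Longrightarrow> (p has_real_derivative f t (p t)) (at t within {- N..N})"
    using ode_solution_exists[of "- N" N L f N] N L cont lip by auto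
  have sub: "(p has_real_derivative f t (p t)) (at t within S)" if "S \<subseteq> {- N..N}" "t \<in> S" for t S
    using p[of t] that by (intro DERIV_subset[OF p]) auto
  have lower: "0 \<le> p t + t" if "t \<in> {- N..N}" for t
  proof (rule barrier[OF _ _ _ that, where d' = "\<lambda>t. f t (p t) + 1"])
    fix t assume t: "t \<in> {- N..N}"
    show "((\<lambda>t. p t + t) has_real_derivative f t (p t) + 1) (at t within {- N..N})"
      by (rule derivative_eq_intros p[OF t] refl)+
    assume "p t + t = 0"
    then have "p t = - t" by simp
    then have "cut t (p t) = - t" using floor_le_roof[of t] by (simp add: cut_def)
    then show "f t (p t) + 1 > 0" using slope_field_lower[of t] by (simp add: f_def)
  qed (simp add: p0)
  \<comment> \<open>The upper barrier has a kink at \<open>0\<close>, hence the comparison in two halves.\<close>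
  have upperl: "0 \<le> 1 - (m + 1) * lam * t - p t" if "t \<in> {- N..0}" for t
  proof (rule barrier[OF _ _ _ that, where d' = "\<lambda>t. - ((m + 1) * lam) - f t (p t)"])
    fix t assume t: "t \<in> {- N..0}"
    show "((\<lambda>t. 1 - (m + 1) * lam * t - p t) has_real_derivative - ((m + 1) * lam) - f t (p t))
        (at t within {- N..0})"
      by (rule derivative_eq_intros sub refl | use t N in force)+
    assume 0: "1 - (m + 1) * lam * t - p t = 0"
    have "roof t = 1 - (m + 1) * lam * t" using t by (simp add: roof_def)
    then have "cut t (p t) = 1 - (m + 1) * lam * t" using floor_le_roof[of t] 0 by (simp add: cut_def)
    then show "- ((m + 1) * lam) - f t (p t) > 0"
      using slope_field_roof_left[of t] t by (simp add: f_def)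
  next
    have "N * 1 \<le> N * ((m + 1) * lam)" using lam_bounds N by (intro mult_left_mono) auto
    then show "0 \<le> 1 - (m + 1) * lam * (- N) - p (- N)" using p0 by (simp add: mult.commute)
  qed
  have upperr: "0 \<le> 1 / (1 + t) - p t" if "t \<in> {0..N}" for t
  proof (rule barrier[OF _ _ _ that, where d' = "\<lambda>t. - ((1 / (1 + t))\<^sup>2) - f t (p t)"])
    fix t assume t: "t \<in> {0..N}"
    show "((\<lambda>t. 1 / (1 + t) - p t) has_real_derivative - ((1 / (1 + t))\<^sup>2) - f t (p t))
        (at t within {0..N})"
      by (rule derivative_eq_intros sub refl | use t N in \<open>force simp: power2_eq_square\<close>)+
    assume 0: "1 / (1 + t) - p t = 0"
    have "roof t = 1 / (1 + t)" using t by (simp add: roof_def)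
    then have "cut t (p t) = 1 / (1 + t)" using floor_le_roof[of t] 0 by (simp add: cut_def)
    then show "- ((1 / (1 + t))\<^sup>2) - f t (p t) > 0"
      using slope_field_roof_right[of t] t by (simp add: f_def)
  next
    show "0 \<le> 1 / (1 + 0) - p 0" using upperl[of 0] N by simp
  qed
  have up: "p t \<le> roof t" if "t \<in> {- N..N}" for t
    using that upperl[of t] upperr[of t] by (cases "t \<le> 0") (auto simp: roof_def)
  have "f t (p t) = slope_field t (p t)" if "t \<in> {- N..N}" for t
    using up[OF that] lower[OF that] by (simp add: f_def cut_def)
  then show thesis using that[of p] p0 p lower up by (metis add.commute minus_le_iff le_minus_iff neg_le_iff_le diff_ge_0_iff_ge diff_minus_eq_add)
qed

text \<open>At \<open>- N\<close> the solution started at \<open>- (N + 1)\<close> lies above the lower barrier, where the solution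
  started at \<open>- N\<close> begins; so the solutions increase with \<open>N\<close>, and the upper barrier makes them
  converge pointwise. Dominated convergence carries the integral equation to the limit.\<close>

lemma slope_exists:
  obtains p where "\<And>u. (p has_real_derivative slope_field u (p u)) (at u)"
    and "\<And>u. - u \<le> p u" and "\<And>u. u * p u < 1"
proof -
  have "\<forall>k. \<exists>p. p (- real k) = real k
      \<and> (\<forall>t\<in>{- real k..real k}. (p has_real_derivative slope_field t (p t)) (at t within {- real k..real k}))
      \<and> (\<forall>t\<in>{- real k..real k}. - t \<le> p t \<and> p t \<le> roof t)"
    using slope_on_interval[of "real _"] by (metis of_nat_0_le_iff)
  then obtain q where q0: "\<And>k. q k (- real k) = real k"
    and q: "\<And>k t. t \<in> {- real k..real k} \<Longrightarrow>
        (q k has_real_derivative slope_field t (q k t)) (at t within {- real k..real k})"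
    and qb: "\<And>k t. t \<in> {- real k..real k} \<Longrightarrow> - t \<le> q k t \<and> q k t \<le> roof t"
    by metis
  have qsub: "(q k has_real_derivative slope_field t (q k t)) (at t within {- real j..real j})"
    if "j \<le> k" "t \<in> {- real j..real j}" for k j t
    by (rule DERIV_subset[OF q]) (use that in auto)
  have qbsub: "- t \<le> q k t" "q k t \<le> roof t" if "j \<le> k" "t \<in> {- real j..real j}" for k j t
    using qb[of t k] that by auto
  have qcont: "continuous_on {- real j..real j} (q k)" if "j \<le> k" for k j
    by (rule DERIV_continuous_on[OF qsub[OF that]])
  have ne1: "t * q k t \<noteq> 1" if "j \<le> k" "t \<in> {- real j..real j}" for k j t
    using region_strict[OF qbsub[OF that]] by simp
  have mono: "q k t \<le> q (Suc k) t" if t: "t \<in> {- real k..real k}" for k t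
  proof -
    define H where "H t = slope_quotient t (q (Suc k) t) (q k t)" for t
    have "q (Suc k) t - q k t
        = (q (Suc k) (- real k) - q k (- real k)) * exp (integral {- real k..t} H)"
    proof (rule linear_ode[OF _ _ t])
      show "continuous_on {- real k..real k} H"
        unfolding H_def slope_quotient_def bend_def
        by (intro continuous_intros qcont) (use ne1[of k] lam_bounds in auto)
      fix t assume t: "t \<in> {- real k..real k}"
      show "((\<lambda>t. q (Suc k) t - q k t) has_real_derivative H t * (q (Suc k) t - q k t))
          (at t within {- real k..real k})"
        unfolding H_def
        by (subst slope_field_diff[symmetric]) (use t ne1[of k] in \<open>auto intro!: DERIV_diff qsub\<close>)
    qed
    moreover have "q (Suc k) (- real k) - q k (- real k) \<ge> 0"
      using qbsub[of k "Suc k" "- real k"] q0[of k] by simp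
    ultimately show ?thesis by (metis exp_ge_zero mult_nonneg_nonneg diff_ge_0_iff_ge)
  qed
  have conv: "\<exists>l. (\<lambda>i. q (i + j) t) \<longlonglongrightarrow> l" if t: "t \<in> {- real j..real j}" for j t
  proof -
    have "incseq (\<lambda>i. q (i + j) t)"
      by (rule incseq_SucI) (use t mono in \<open>auto intro: order.trans\<close>)
    moreover have "\<forall>i. q (i + j) t \<le> roof t" using qbsub[of j _ t] t by auto
    ultimately show ?thesis using incseq_convergent by metis
  qed
  define p where "p t = lim (\<lambda>k. q k t)" for t
  have lim: "(\<lambda>i. q (i + j) t) \<longlonglongrightarrow> p t" if "t \<in> {- real j..real j}" for j t
    using conv[OF that] LIMSEQ_offset[of "\<lambda>k. q k t" j] by (metis p_def limI)
  have pb: "- t \<le> p t" "p t \<le> roof t" for t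
  proof -
    obtain j where "\<bar>t\<bar> \<le> real j" using real_arch_simple by blast
    then have t: "t \<in> {- real j..real j}" by auto
    show "- t \<le> p t" "p t \<le> roof t"
      using qbsub[OF _ t] by (auto intro!: LIMSEQ_le_const[OF lim[OF t]] LIMSEQ_le_const2[OF lim[OF t]])
  qed
  have p1: "t * p t < 1" for t by (rule region_strict[OF pb])
  have "(p has_real_derivative slope_field t (p t)) (at t)" for t
  proof -
    obtain j0 where "\<bar>t\<bar> \<le> real j0" using real_arch_simple by blast
    define j where "j = Suc j0"
    have t: "- real j < t" "t < real j" using \<open>\<bar>t\<bar> \<le> real j0\<close> by (auto simp: j_def)
    define I where "I = {- real j..real j}"
    define B where "B = (1 + (1 + 2 * real j)\<^sup>2) * (1 + real j)"
    have bound: "norm (slope_field s (q k s)) \<le> B * (m + B / lam)" if "j \<le> k" "s \<in> I" for k s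
    proof -
      have s: "\<bar>s\<bar> \<le> real j" using that by (auto simp: I_def)
      have r: "1 - s * q k s \<ge> 1 / (1 + real j)" "\<bar>q k s\<bar> \<le> 1 + 2 * real j"
        using region[OF qbsub[of j k s] s] that by (auto simp: I_def)
      have "(q k s)\<^sup>2 \<le> (1 + 2 * real j)\<^sup>2" using r(2) by (simp add: abs_le_square_iff[symmetric])
      then have "bend s (q k s) \<le> (1 + (1 + 2 * real j)\<^sup>2) / (1 / (1 + real j))"
        unfolding bend_def using r by (intro frac_le) auto
      then have b: "bend s (q k s) \<le> B" by (simp add: B_def)
      have b0: "0 < bend s (q k s)" using r(1) by (intro bend_pos) (smt (verit) divide_pos_pos of_nat_0_le_iff)
      have "\<bar>m - bend s (q k s) / lam\<bar> \<le> m + bend s (q k s) / lam"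
        using m b0 lam_bounds by (simp add: abs_le_iff)
      also have "\<dots> \<le> m + B / lam" using b lam_bounds by (simp add: divide_right_mono)
      finally show ?thesis
        unfolding slope_field_def real_norm_def abs_mult using b b0 m by (intro mult_mono) auto
    qed
    have dom: "(\<lambda>s. slope_field s (p s)) integrable_on {- real j..s} \<and>
        p s - p (- real j) = integral {- real j..s} (\<lambda>s. slope_field s (p s))" if s: "s \<in> I" for s
    proof -
      have hi: "((\<lambda>s. slope_field s (q (i + j) s)) has_integral (q (i + j) s - q (i + j) (- real j)))
          {- real j..s}" for i
        using s by (intro fundamental_theorem_of_calculus)
          (auto intro!: DERIV_subset[OF qsub[of j]] simp: I_def simp flip: has_real_derivative_iff_has_vector_derivative)
      have D: "(\<lambda>s. slope_field s (p s)) integrable_on {- real j..s}"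
        "(\<lambda>i. integral {- real j..s} (\<lambda>s. slope_field s (q (i + j) s)))
           \<longlonglongrightarrow> integral {- real j..s} (\<lambda>s. slope_field s (p s))"
      proof (atomize(full), rule conjI)
        note dc = dominated_convergence[where f = "\<lambda>i s. slope_field s (q (i + j) s)"
            and g = "\<lambda>s. slope_field s (p s)" and S = "{- real j..s}" and h = "\<lambda>_. B * (m + B / lam)"]
        have "(\<lambda>i. slope_field r (q (i + j) r)) \<longlonglongrightarrow> slope_field r (p r)" if "r \<in> {- real j..s}" for r
          unfolding slope_field_def bend_def
          by (intro tendsto_intros lim) (use p1[of r] that s lam_bounds in \<open>auto simp: I_def\<close>)
        note dc' = dc[OF has_integral_integrable[OF hi] integrable_const_ivl _ this]
        show "(\<lambda>s. slope_field s (p s)) integrable_on {- real j..s}"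
          "(\<lambda>i. integral {- real j..s} (\<lambda>s. slope_field s (q (i + j) s)))
           \<longlonglongrightarrow> integral {- real j..s} (\<lambda>s. slope_field s (p s))"
          by (rule dc'; use bound s in \<open>auto simp: I_def\<close>)+
      qed
      moreover have "(\<lambda>i. q (i + j) s - q (i + j) (- real j)) \<longlonglongrightarrow> p s - p (- real j)"
        using s by (intro tendsto_diff lim) (auto simp: I_def)
      ultimately show ?thesis
        using integral_unique[OF hi] by (auto intro: LIMSEQ_unique)
    qed
    have dom': "(\<lambda>s. slope_field s (p s)) integrable_on {- real j..real j}" using dom[of "real j"] by (simp add: I_def)
    have pI: "p s = p (- real j) + integral {- real j..s} (\<lambda>s. slope_field s (p s))" if "s \<in> I" for s
      using dom[OF that] by simp
    have "continuous_on I (\<lambda>s. p (- real j) + integral {- real j..s} (\<lambda>s. slope_field s (p s)))"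
      unfolding I_def by (intro continuous_intros indefinite_integral_continuous_1 dom')
    then have "continuous_on I p" using pI by (subst continuous_on_cong[OF refl pI])
    then have "continuous_on I (\<lambda>s. slope_field s (p s))"
      using p1 by (intro continuous_slope_field) (auto simp: less_le)
    then have "((\<lambda>s. p (- real j) + integral {- real j..s} (\<lambda>s. slope_field s (p s)))
        has_real_derivative slope_field t (p t)) (at t within I)"
      using integral_has_real_derivative[of "- real j" "real j" "\<lambda>s. slope_field s (p s)" t] t
      by (auto simp: I_def intro!: derivative_eq_intros)
    then have "(p has_real_derivative slope_field t (p t)) (at t within I)"
      by (rule has_field_derivative_transform_within[OF _ zero_less_one _ pI[symmetric]])
         (use t in \<open>auto simp: I_def\<close>)
    then show ?thesis using t by (simp add: I_def at_within_Icc_at)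
  qed
  then show thesis by (rule that[OF _ pb(1) p1])
qed

section \<open>Slopes below the diagonal decay\<close>

text \<open>Large enough that \<open>x * P \<ge> decay_threshold\<close> makes \<open>1 / (1 + x * P)\<close> small compared both with
  \<open>m * lam\<close> and with the excess \<open>(m + 1) * lam - 1\<close>.\<close>

definition decay_threshold :: real where
  "decay_threshold = 4 / (m * lam) + 4 / ((m + 1) * lam - 1)"

lemma decay_threshold_bounds:
  assumes "M \<ge> decay_threshold"
  shows "M \<ge> 4" "1 / (1 + M) \<le> m * lam / 4" "2 / (1 + M) \<le> ((m + 1) * lam - 1) / 2"
proof -
  define c where "c = m * lam"
  define d where "d = (m + 1) * lam - 1"
  have c: "0 < c" "c < 1" using lam_bounds m by (auto simp: c_def)
  have d: "0 < d" using lam_bounds by (auto simp: d_def)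
  have "4 / c \<ge> 4" using c by (simp add: field_simps)
  moreover have "4 / d > 0" using d by simp
  ultimately have M: "M \<ge> 4" "M \<ge> 4 / c" "M \<ge> 4 / d" using assms c d
    unfolding decay_threshold_def c_def[symmetric] d_def[symmetric] by linarith+
  have "4 / c \<le> 1 + M" "4 / d \<le> 1 + M" using M by auto
  then have "4 \<le> c * (1 + M)" "4 \<le> d * (1 + M)" using c d by (simp_all add: field_simps)
  then show "M \<ge> 4" "1 / (1 + M) \<le> m * lam / 4" "2 / (1 + M) \<le> ((m + 1) * lam - 1) / 2"
    unfolding c_def[symmetric] d_def[symmetric] using M by (simp_all add: field_simps)
qed

lemma neg_slope_field: "- slope_field u p = bend u p * (bend u p - m * lam) / lam"
  using lam_bounds by (simp add: slope_field_def field_simps)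

text \<open>The equation \<open>dP/dx = - slope_field (- x) P\<close> holds for \<open>P x = p (- x)\<close> and, by reflection, for
  \<open>P x = - p x\<close>, whenever \<open>p\<close> solves the slope equation. Put \<open>g = P / x\<close> and \<open>e = (1 - g) / (1 + x P)\<close>. Then \<open>bend = g + e\<close>, and
  \<open>lam (x g') = g (g - (m + 1) lam) + e (2 g + e - m lam)\<close>. While \<open>g \<le> 1\<close> and \<open>x P\<close> is large, the
  right-hand side is at most a negative multiple of \<open>g\<close>, so \<open>g\<close> decays like a negative power of \<open>x\<close>.
  Hence \<open>bend\<close> drops below \<open>m lam / 2\<close>, where \<open>P' \<le> - (m / 2) / (1 + x P)\<close>; this forces \<open>P\<^sup>2\<close> to
  fall at least as fast as \<open>- (m / 2) ln x\<close>, which is absurd.\<close>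

lemma no_slow_escape:
  fixes P :: "real \<Rightarrow> real"
  assumes der: "\<And>x. x \<ge> x1 \<Longrightarrow> (P has_real_derivative - slope_field (- x) (P x)) (at x)"
    and le: "\<And>x. x \<ge> x1 \<Longrightarrow> P x \<le> x"
    and big: "\<And>x. x \<ge> x1 \<Longrightarrow> x * P x \<ge> decay_threshold"
  shows False
proof -
  define c where "c = m * lam"
  define d where "d = (m + 1) * lam - 1"
  define \<sigma> where "\<sigma> = d / (2 * lam)"
  have c: "0 < c" "c < 1" using lam_bounds m by (auto simp: c_def)
  have lam: "0 < lam" "lam < 1" using lam_bounds by auto
  have d: "0 < d" using lam_bounds by (auto simp: d_def)
  have \<sigma>: "\<sigma> > 0" using d lam by (simp add: \<sigma>_def)
  define a where "a = max x1 1"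
  define A where "A x = bend (- x) (P x)" for x
  define P' where "P' x = A x * (A x - c) / lam" for x
  have derP: "(P has_real_derivative P' x) (at x)" if "x \<ge> a" for x
    using der[of x] that by (simp add: neg_slope_field P'_def A_def c_def a_def)
  define g where "g x = P x / x" for x
  define e where "e x = (1 - g x) / (1 + x * P x)" for x
  have basic: "x \<ge> 1" "P x > 0" "x * P x \<ge> 4" "0 < g x" "g x \<le> 1" "0 \<le> e x" "e x \<le> c / 4"
    "e x \<le> d / 4" "A x = g x + e x" if "x \<ge> a" for x
  proof -
    show x: "x \<ge> 1" using that by (simp add: a_def)
    have x1: "x \<ge> x1" using that by (simp add: a_def)
    note C = decay_threshold_bounds[OF big[OF x1]]
    show w: "x * P x \<ge> 4" by (rule C)
    then show P: "P x > 0" using x by (smt (verit) mult_nonneg_nonpos)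
    show g: "0 < g x" "g x \<le> 1" using P x le[OF x1] by (auto simp: g_def)
    show "0 \<le> e x" using g w by (simp add: e_def)
    have "e x \<le> 1 / (1 + x * P x)" unfolding e_def using g w by (intro divide_right_mono) auto
    then show "e x \<le> c / 4" "e x \<le> d / 4" using C by (auto simp: c_def d_def)
    have "x + x * (x * P x) \<noteq> 0" using x w by (smt (verit) mult_pos_pos)
    then show "A x = g x + e x" using x w
      unfolding A_def bend_def e_def g_def by (simp add: divide_simps) algebra
  qed
  have key: "P' x - g x \<le> - \<sigma> * g x" if x: "x \<ge> a" for x
  proof -
    note b = basic[OF x]
    have "lam * (P' x - g x) = g x * (g x - (d + 1)) + e x * (2 * g x + e x - c)"
      unfolding P'_def b(9) d_def c_def using lam by (simp add: field_simps)
    also have "g x * (g x - (d + 1)) \<le> g x * (- d)" using b by (intro mult_left_mono) auto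
    also have "e x * (2 * g x + e x - c) \<le> e x * (2 * g x)" using b by (intro mult_left_mono) auto
    also have "e x * (2 * g x) \<le> d / 4 * (2 * g x)" using b by (intro mult_right_mono) auto
    finally have "lam * (P' x - g x) \<le> - (d / 2) * g x" by (simp add: algebra_simps)
    then show ?thesis using lam by (simp add: \<sigma>_def field_simps)
  qed
  \<comment> \<open>\<open>V x = ln (g x) + \<sigma> * ln x\<close>, so its monotonicity is the power decay of \<open>g\<close>.\<close>
  define V where "V x = ln (P x) + (\<sigma> - 1) * ln x" for x
  have V: "V x \<le> V a" if "a \<le> x" for x
  proof (rule DERIV_nonpos_imp_nonincreasing[OF that], intro exI conjI)
    fix x assume x: "a \<le> x"
    note b = basic[OF x]
    show "(V has_real_derivative P' x / P x + (\<sigma> - 1) / x) (at x)"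
      unfolding V_def using b by (auto intro!: derivative_eq_intros derP x)
    have "P' x / P x + (\<sigma> - 1) / x = (P' x - g x + \<sigma> * g x) / P x"
      using b unfolding g_def by (simp add: field_simps)
    also have "\<dots> \<le> 0" using key[OF x] b by (simp add: divide_nonpos_pos)
    finally show "P' x / P x + (\<sigma> - 1) / x \<le> 0" .
  qed
  \<comment> \<open>From \<open>b\<close> on, \<open>V x \<le> V a\<close> gives \<open>ln (g x) \<le> ln (c / 4)\<close>.\<close>
  define b where "b = max a (exp ((V a - ln (c / 4)) / \<sigma>))"
  have ba: "b \<ge> a" by (simp add: b_def)
  have small: "g x \<le> c / 4" if "x \<ge> b" for x
  proof -
    have x: "x \<ge> a" using that ba by simp
    note bs = basic[OF x]
    have "exp ((V a - ln (c / 4)) / \<sigma>) \<le> x" using that by (simp add: b_def)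
    then have "(V a - ln (c / 4)) / \<sigma> \<le> ln x" using bs by (metis ln_ge_iff less_le_trans zero_less_one)
    then have 1: "V a - ln (c / 4) \<le> \<sigma> * ln x" using \<sigma> by (simp add: field_simps)
    have "ln (g x) = V x - \<sigma> * ln x" using bs by (simp add: g_def V_def ln_div algebra_simps)
    also have "\<dots> \<le> ln (c / 4)" using V[OF x] 1 by simp
    finally show ?thesis using bs c by (simp add: ln_le_cancel_iff)
  qed
  define W where "W x = (P x)\<^sup>2 + m / 2 * ln x" for x
  have W: "W x \<le> W b" if "b \<le> x" for x
  proof (rule DERIV_nonpos_imp_nonincreasing[OF that], intro exI conjI)
    fix x assume xb: "b \<le> x"
    then have x: "x \<ge> a" using ba by simp
    note bs = basic[OF x]
    show "(W has_real_derivative 2 * P x * P' x + m / 2 / x) (at x)"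
      unfolding W_def using bs by (auto intro!: derivative_eq_intros derP x)
    have "A x \<le> c / 2" using small[OF xb] bs by simp
    have A1: "1 / (1 + x * P x) \<le> A x" unfolding A_def bend_def using bs by (simp add: divide_right_mono)
    have "A x * (A x - c) \<le> A x * (- c / 2)" using \<open>A x \<le> c / 2\<close> bs by (intro mult_left_mono) auto
    also have "\<dots> \<le> 1 / (1 + x * P x) * (- c / 2)" using A1 c by (intro mult_right_mono_neg) auto
    finally have "P' x \<le> 1 / (1 + x * P x) * (- c / 2) / lam"
      unfolding P'_def using lam by (intro divide_right_mono) auto
    also have "\<dots> = - m / 2 / (1 + x * P x)"
    proof -
      have "1 / z * (- c / 2) / lam = - m / 2 / z" for z using lam by (simp add: c_def)
      then show ?thesis .
    qed
    finally have "2 * P x * P' x \<le> 2 * P x * (- m / 2 / (1 + x * P x))"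
      using bs by (intro mult_left_mono) auto
    also have "\<dots> = - m * (P x / (1 + x * P x))"
    proof -
      have "2 * y * (- m / 2 / z) = - m * (y / z)" for y z by simp
      then show ?thesis .
    qed
    also have "\<dots> \<le> - m * (1 / (2 * x))"
      using m bs by (intro mult_left_mono_neg) (auto simp: field_simps)
    finally show "2 * P x * P' x + m / 2 / x \<le> 0" by simp
  qed
  define x where "x = max b (exp (2 * (W b + 1) / m))"
  have x: "x \<ge> b" by (simp add: x_def)
  have "x > 0" by (simp add: x_def less_max_iff_disj)
  then have "2 * (W b + 1) / m \<le> ln x" by (subst ln_ge_iff) (simp_all add: x_def)
  then have "W b + 1 \<le> m / 2 * ln x" using m by (simp add: field_simps)
  moreover have "(P x)\<^sup>2 \<ge> 0" by simp
  ultimately have "W x \<ge> W b + 1" unfolding W_def[of x] by linarith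
  then show False using W[OF x] by simp
qed

text \<open>For \<open>u \<rightarrow> \<infinity>\<close>: by \<open>no_slow_escape\<close> the quantity \<open>- u p\<close> drops below the threshold \<open>M\<close> at arbitrarily late
  times, and for large \<open>u\<close> it cannot cross \<open>M\<close> upwards again. This bound makes
  \<open>1 / (u (1 - u p))\<close>, the logarithmic derivative of \<open>y\<close>, non-integrable at infinity.\<close>

lemma slope_decay:
  fixes p :: "real \<Rightarrow> real"
  assumes der: "\<And>u. (p has_real_derivative slope_field u (p u)) (at u)"
    and low: "\<And>u. - u \<le> p u"
  obtains u1 M where "u1 > 0" "M > 0" "\<And>u. u \<ge> u1 \<Longrightarrow> - (u * p u) \<le> M"
proof -
  define M where "M = decay_threshold"
  note C = decay_threshold_bounds[of M, unfolded M_def, OF order_refl, folded M_def]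
  \<comment> \<open>From \<open>a\<close> on the hyperbola \<open>x P = M\<close> lies in the region where \<open>bend\<close> is at most \<open>m lam / 2\<close>,
    and the slope of \<open>P\<close> there is more negative than that of the hyperbola.\<close>
  define a where "a = 1 + M + 2 * M * (1 + M)"
  define P where "P x = - p x" for x
  have derP: "(P has_real_derivative - slope_field (- x) (P x)) (at x)" for x
    unfolding P_def slope_field_reflect by (intro derivative_intros der)
  have "2 * M * (1 + M) > 0" using C(1) by simp
  then have a: "a > 0" "a \<ge> M" "a > 2 * M * (1 + M)" "a \<ge> 1" using C(1) unfolding a_def by linarith+
  have "\<exists>b\<ge>a. b * P b < M"
  proof (rule ccontr)
    assume "\<not> ?thesis"
    then show False
      using no_slow_escape[of a P, OF derP] low by (force simp: P_def M_def not_less minus_le_iff)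
  qed
  then obtain b where b: "b \<ge> a" "b * P b < M" by blast
  have "M - t * P t \<ge> 0" if t: "t \<ge> b" for t
  proof (rule barrier[where a = b and b = t and t = t and d = "\<lambda>t. M - t * P t" and d' = "\<lambda>x. - (P x - x * slope_field (- x) (P x))"])
    fix x assume x: "x \<in> {b..t}"
    show "((\<lambda>t. M - t * P t) has_real_derivative - (P x - x * slope_field (- x) (P x)))
        (at x within {b..t})"
      by (rule derivative_eq_intros DERIV_subset[OF derP] refl | simp)+
    assume 0: "M - x * P x = 0"
    have xa: "x \<ge> a" using x b by auto
    then have x0: "x > 0" using a by simp
    then have P: "P x = M / x" using 0 by (simp add: field_simps)
    define A where "A = bend (- x) (P x)"
    have A: "A = (1 + (M / x)\<^sup>2) / (1 + M)" unfolding A_def bend_def P using x0 by simp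
    have "(M / x)\<^sup>2 \<le> 1" using xa a x0 C by (intro power_le_one) auto
    then have "A \<le> 2 / (1 + M)" unfolding A using C by (intro divide_right_mono) auto
    then have A2: "A \<le> m * lam / 2" using C(2) by linarith
    have A1: "1 / (1 + M) \<le> A" unfolding A using C by (intro divide_right_mono) auto
    have "A > 0" using A1 C(1) by (smt (verit) divide_pos_pos)
    have "m / 2 * (1 / (1 + M)) \<le> m / 2 * A" using A1 m by (intro mult_left_mono) auto
    also have "\<dots> \<le> slope_field (- x) (P x)"
      unfolding slope_field_def A_def[symmetric]
      using A2 \<open>A > 0\<close> lam_bounds by (simp add: field_simps)
    finally have "m / (2 * (1 + M)) \<le> slope_field (- x) (P x)" by simp
    then have 1: "x * (m / (2 * (1 + M))) \<le> x * slope_field (- x) (P x)"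
      using x0 by (intro mult_left_mono) auto
    have "M / x \<le> M" using xa a C x0 by (simp add: field_simps)
    also have "M * (2 * (1 + M)) < x * m" 
    proof -
      have "M * (2 * (1 + M)) < x" using xa a(3) by (simp add: algebra_simps)
      also have "x \<le> x * m" using m x0 by simp
      finally show ?thesis .
    qed
    then have "M < x * (m / (2 * (1 + M)))" using C by (simp add: field_simps)
    finally show "0 < - (P x - x * slope_field (- x) (P x))" using 1 P by simp
  qed (use b t in auto)
  then show thesis using that[of b M] b a C by (force simp: P_def)
qed

section \<open>Uniqueness of the slope that tends to infinity\<close>

text \<open>A solution that tends to infinity but gets below \<open>P = x\<close> stays below, because the field crosses
  this line in one direction only; that contradicts \<open>no_slow_escape\<close>.\<close>

lemma slope_above_diagonal:
  fixes P :: "real \<Rightarrow> real"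
  assumes der: "\<And>x. x \<ge> x0 \<Longrightarrow> (P has_real_derivative - slope_field (- x) (P x)) (at x)"
    and lim: "filterlim P at_top at_top"
  shows "eventually (\<lambda>x. x \<le> P x) at_top"
proof -
  obtain b where b: "\<And>x. x \<ge> b \<Longrightarrow> P x \<ge> decay_threshold"
    using lim unfolding filterlim_at_top eventually_at_top_linorder by blast
  define a where "a = max b (max x0 1)"
  have "x \<le> P x" if x: "x \<ge> a" for x
  proof (rule ccontr)
    assume neg: "\<not> x \<le> P x"
    have "y - P y \<ge> 0" if "y \<ge> x" for y
    proof (rule barrier[where a = x and b = y and t = y and d = "\<lambda>y. y - P y" and d' = "\<lambda>z. 1 + slope_field (- z) (P z)"])
      fix z assume z: "z \<in> {x..y}"
      then have "z \<ge> x0" using x by (auto simp: a_def)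
      then show "((\<lambda>y. y - P y) has_real_derivative 1 + slope_field (- z) (P z)) (at z within {x..y})"
        by (auto intro!: derivative_eq_intros DERIV_subset[OF der])
      assume "z - P z = 0"
      then show "0 < 1 + slope_field (- z) (P z)" using slope_field_lower[of "- z"] by simp
    qed (use that neg in auto)
    moreover have "y * P y \<ge> decay_threshold" if "y \<ge> x" for y
    proof -
      have "P y \<ge> decay_threshold" "y \<ge> 1" using b[of y] that x by (auto simp: a_def)
      moreover have "decay_threshold \<ge> 4" using decay_threshold_bounds(1) by simp
      ultimately show ?thesis using mult_mono[of 1 y decay_threshold "P y"] by simp
    qed
    ultimately show False
      using no_slow_escape[of x P] der x by (auto simp: a_def)
  qed
  then show ?thesis unfolding eventually_at_top_linorder by blast
qed

text \<open>Let \<open>E = P - (m + 1) lam x - 1\<close>. If \<open>E\<close> is positive once, it stays so, and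
  \<open>bend - (m + 1) lam \<ge> E / (x + 1)\<close> leads to the Riccati inequality
  \<open>(x + 1) E' \<ge> E + E\<^sup>2 / (lam (x + 1))\<close>. Therefore \<open>(x + 1) / E + ln (x + 1) / lam\<close> does not
  increase, so that \<open>(x + 1) / E\<close> would have to become negative.\<close>

lemma slope_below_line:
  fixes P :: "real \<Rightarrow> real"
  assumes der: "\<And>x. x \<ge> x0 \<Longrightarrow> (P has_real_derivative - slope_field (- x) (P x)) (at x)"
    and lim: "filterlim P at_top at_top"
  shows "eventually (\<lambda>x. P x \<le> (m + 1) * lam * x + 1) at_top"
proof -
  define k where "k = (m + 1) * lam"
  have k: "1 < k" "k < 2" and lam: "0 < lam" "lam < 1" using lam_bounds by (auto simp: k_def)
  obtain b where b: "\<And>x. x \<ge> b \<Longrightarrow> P x \<ge> 1"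
    using lim unfolding filterlim_at_top eventually_at_top_linorder by blast
  define a where "a = max b (max x0 1)"
  define E where "E x = P x - k * x - 1" for x
  define A where "A x = bend (- x) (P x)" for x
  define E' where "E' x = (A x - k) * (A x + lam) / lam" for x
  have derE: "(E has_real_derivative E' x) (at x)" if "x \<ge> a" for x
  proof -
    have "x \<ge> x0" using that by (simp add: a_def)
    then show ?thesis
      unfolding E_def E'_def A_def using slope_field_factor[of "- x" "P x"]
      by (auto intro!: derivative_eq_intros der simp: k_def)
  qed
  have "E x \<le> 0" if x: "x \<ge> a" for x
  proof (rule ccontr)
    assume pos: "\<not> E x \<le> 0"
    have E0: "E y \<ge> 0" if "y \<ge> x" for y
    proof (rule barrier[where a = x and b = y and t = y and d = E and d' = E'])
      fix z assume z: "z \<in> {x..y}"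
      then show "(E has_real_derivative E' z) (at z within {x..y})"
        using x by (auto intro!: DERIV_subset[OF derE])
      assume "E z = 0"
      then have "P z = 1 - (m + 1) * lam * (- z)" by (simp add: E_def k_def)
      then have "slope_field (- z) (P z) < - k"
        using slope_field_roof_left[of "- z"] x z by (simp add: k_def a_def)
      then show "0 < E' z"
        using slope_field_factor[of "- z" "P z"] by (simp add: E'_def A_def k_def)
    qed (use that pos in auto)
    have gap: "A y - k \<ge> E y / (y + 1)" if "y \<ge> x" for y
    proof -
      have y: "y \<ge> 1" "P y \<ge> 1" using that x b[of y] by (auto simp: a_def)
      then have yP: "1 + y * P y > 0" by (simp add: add_pos_nonneg)
      have "k - 1 \<le> P y" using k y by simp
      have "E y * (1 + y * P y) \<le> E y * (P y * (y + 1))"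
        using E0[OF that] y by (intro mult_left_mono) (auto simp: algebra_simps)
      then have "E y / (y + 1) \<le> E y * P y / (1 + y * P y)"
        using y yP by (simp add: field_simps)
      also have "\<dots> \<le> (1 - k + P y * (P y - k * y)) / (1 + y * P y)"
        using \<open>k - 1 \<le> P y\<close> yP by (intro divide_right_mono) (auto simp: E_def algebra_simps)
      also have "\<dots> = A y - k"
        using yP by (simp add: A_def bend_def field_simps power2_eq_square)
      finally show ?thesis .
    qed
    have E'E: "E' y * (y + 1) \<ge> E y + (E y)\<^sup>2 / (lam * (y + 1))" if "y \<ge> x" for y
    proof -
      define h where "h = E y / (y + 1)"
      have y: "y \<ge> 1" using that x by (auto simp: a_def)
      have h: "h \<ge> 0" "A y - k \<ge> h" using E0[OF that] y gap[OF that] by (auto simp: h_def)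
      have "h * (h + lam) \<le> (A y - k) * (A y + lam)" using h lam k by (intro mult_mono) auto
      then have "h * (h + lam) / lam \<le> E' y" unfolding E'_def using lam by (intro divide_right_mono) auto
      then have "h * (h + lam) / lam * (y + 1) \<le> E' y * (y + 1)" using y by (intro mult_right_mono) auto
      moreover have "h * (h + lam) / lam * (y + 1) = E y + (E y)\<^sup>2 / (lam * (y + 1))"
      proof -
        have "h * (h + lam) / lam * w = h * w + (h * w)\<^sup>2 / (lam * w)" if "w > 0" for w
          using that lam by (simp add: field_simps power2_eq_square)
        from this[of "y + 1"] show ?thesis using y by (simp add: h_def)
      qed
      ultimately show ?thesis by simp
    qed
    have Epos: "E y > 0" if "y \<ge> x" for y
    proof -
      have "E x \<le> E y"
      proof (rule DERIV_nonneg_imp_nondecreasing[OF that], intro exI conjI)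
        fix z assume z: "x \<le> z"
        show "(E has_real_derivative E' z) (at z)" using z x by (intro derE) auto
        have z1: "z \<ge> 1" using z x by (auto simp: a_def)
        have "A z - k \<ge> 0" using gap[OF z] E0[OF z] z1 by (smt (verit) divide_nonneg_nonneg)
        then show "0 \<le> E' z" unfolding E'_def using k lam by simp
      qed
      then show ?thesis using pos by simp
    qed
    define Q where "Q y = (y + 1) / E y + ln (y + 1) / lam" for y
    have Q: "Q y \<le> Q x" if "x \<le> y" for y
    proof (rule DERIV_nonpos_imp_nonincreasing[OF that], intro exI conjI)
      fix z assume z: "x \<le> z"
      have z1: "z \<ge> 1" using z x by (auto simp: a_def)
      have za: "z \<ge> a" using z x by simp
      show "(Q has_real_derivative (E z - (z + 1) * E' z) / (E z)\<^sup>2 + 1 / (z + 1) / lam) (at z)"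
        unfolding Q_def using Epos[OF z] z1 lam
        by (auto intro!: derivative_eq_intros derE za simp: power2_eq_square)
      have "(E z - (z + 1) * E' z) / (E z)\<^sup>2 \<le> - ((E z)\<^sup>2 / (lam * (z + 1))) / (E z)\<^sup>2"
        using E'E[OF z] by (intro divide_right_mono) (auto simp: mult.commute)
      also have "\<dots> = - (1 / (z + 1) / lam)" using Epos[OF z] by simp
      finally show "(E z - (z + 1) * E' z) / (E z)\<^sup>2 + 1 / (z + 1) / lam \<le> 0" by simp
    qed
    define y where "y = max x (exp (lam * Q x))"
    have y: "y \<ge> x" "y \<ge> 1" using x by (auto simp: y_def a_def)
    have "lam * Q x \<le> ln (y + 1)" using y by (subst ln_ge_iff) (auto simp: y_def max_def)
    then have "Q x \<le> ln (y + 1) / lam" using lam by (simp add: field_simps)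
    moreover have "(y + 1) / E y > 0" using Epos[OF y(1)] y by simp
    ultimately show False using Q[OF y(1)] by (simp add: Q_def)
  qed
  then show ?thesis
    unfolding eventually_at_top_linorder E_def k_def by (force intro: exI[of _ a])
qed

text \<open>The difference \<open>D\<close> of two such solutions satisfies \<open>D' = H D\<close>. The two preceding lemmas confine \<open>D\<close>
  to linear growth, while \<open>x H\<close> is eventually at least some \<open>\<beta> > 1\<close>: above the diagonal \<open>bend\<close> is at
  least \<open>1\<close>, so \<open>x H\<close> is asymptotically at least \<open>s = 2 / lam - m\<close>, and \<open>lam < 1 / m\<close> gives
  \<open>s > 1\<close>. Thus \<open>D\<^sup>2 x powr (- 2 \<beta>)\<close> is nondecreasing and tends to \<open>0\<close>, whence \<open>D = 0\<close>.\<close>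

lemma escaping_slopes_agree:
  fixes P Q :: "real \<Rightarrow> real"
  assumes derP: "\<And>x. x \<ge> x0 \<Longrightarrow> (P has_real_derivative - slope_field (- x) (P x)) (at x)"
    and limP: "filterlim P at_top at_top"
    and derQ: "\<And>x. x \<ge> x0 \<Longrightarrow> (Q has_real_derivative - slope_field (- x) (Q x)) (at x)"
    and limQ: "filterlim Q at_top at_top"
  shows "eventually (\<lambda>x. P x = Q x) at_top"
proof -
  define k where "k = (m + 1) * lam"
  define s where "s = 2 / lam - m"
  define \<beta> where "\<beta> = (1 + s) / 2"
  have lam: "0 < lam" "lam < 1" and k: "1 < k" "k < 2" using lam_bounds by (auto simp: k_def)
  have s: "s > 1" using lam_bounds by (simp add: s_def field_simps)
  have \<beta>: "\<beta> > 1" using s by (simp add: \<beta>_def)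
  have "eventually (\<lambda>x. x \<le> P x \<and> x \<le> Q x \<and> P x \<le> k * x + 1 \<and> Q x \<le> k * x + 1) at_top"
    unfolding k_def
    by (intro eventually_conj slope_above_diagonal[OF derP limP] slope_above_diagonal[OF derQ limQ]
        slope_below_line[OF derP limP] slope_below_line[OF derQ limQ])
  then obtain b where b: "\<And>x. x \<ge> b \<Longrightarrow> x \<le> P x \<and> x \<le> Q x \<and> P x \<le> k * x + 1 \<and> Q x \<le> k * x + 1"
    unfolding eventually_at_top_linorder by blast
  \<comment> \<open>Up to a relative error of \<open>2 / x\<close>, \<open>x H\<close> is at least \<open>s\<close>; the summand \<open>4 s / (s - 1)\<close> is what
    brings this error below \<open>1 - \<beta> / s = (s - 1) / (2 s)\<close>.\<close>
  define a where "a = max b (max x0 (1 + 4 * s / (s - 1)))"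
  define D where "D x = P x - Q x" for x
  define H where "H x = - slope_quotient (- x) (P x) (Q x)" for x
  have a: "x \<ge> 1" "x \<ge> 4 * s / (s - 1)" "x \<ge> x0" "x \<ge> b" if "x \<ge> a" for x
  proof -
    have "4 * s / (s - 1) > 0" using s by simp
    then show "x \<ge> 1" "x \<ge> 4 * s / (s - 1)" "x \<ge> x0" "x \<ge> b" using that by (auto simp: a_def)
  qed
  have H: "x * H x \<ge> \<beta>" if x: "x \<ge> a" for x
  proof -
    note ax = a[OF x]
    define p where "p = P x" define q where "q = Q x"
    have pq: "p \<ge> x" "q \<ge> x" using b[OF ax(4)] by (auto simp: p_def q_def)
    have bend: "bend (- x) r \<ge> 1" if "r \<ge> x" for r
    proof -
      have "x * r \<le> r * r" using that ax by (intro mult_right_mono) auto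
      moreover have "x * r \<ge> 0" using that ax by simp
      ultimately show ?thesis by (simp add: bend_def power2_eq_square)
    qed
    define F where "F = (p + q - x + x * p * q) / ((1 + x * p) * (1 + x * q))"
    have "slope_quotient (- x) p q = F * (m - (bend (- x) p + bend (- x) q) / lam)"
      by (simp add: slope_quotient_def F_def)
    then have "H x = F * ((bend (- x) p + bend (- x) q) / lam - m)"
      by (simp add: H_def p_def[symmetric] q_def[symmetric] right_diff_distrib)
    then have Hx: "x * H x = (x * F) * ((bend (- x) p + bend (- x) q) / lam - m)" by simp
    have den: "(1 + x * p) * (1 + x * q) \<ge> x ^ 4" (is "?den \<ge> _")
    proof -
      have "x * x \<le> x * p" "x * x \<le> x * q" using ax pq by auto
      then have "x * x \<le> 1 + x * p" "x * x \<le> 1 + x * q" by linarith+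
      then have "(x * x) * (x * x) \<le> ?den" using ax pq by (intro mult_mono) auto
      then show ?thesis by (simp add: power4_eq_xxxx mult.assoc)
    qed
    have den0: "?den > 0" using den ax by (smt (verit) zero_less_power)
    have "1 - x * F = (1 + x * x) / ?den"
      unfolding F_def using den0 by (simp add: field_simps)
    also have "\<dots> \<le> (2 * x\<^sup>2) / x ^ 4"
      using den ax by (intro frac_le) (auto simp: power2_eq_square mult_ge1_I)
    also have "\<dots> = 2 / x\<^sup>2" using ax by (simp add: field_simps power2_eq_square power4_eq_xxxx)
    also have "\<dots> \<le> 2 / x"
      using ax by (intro divide_left_mono) (auto simp: power2_eq_square)
    also have "\<dots> \<le> (s - 1) / (2 * s)"
      using ax s by (simp add: field_simps)
    finally have "x * F \<ge> 1 - (s - 1) / (2 * s)" by simp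
    then have xF: "x * F \<ge> \<beta> / s" using s by (simp add: \<beta>_def field_simps)
    have "2 / lam \<le> (bend (- x) p + bend (- x) q) / lam"
      using bend[OF pq(1)] bend[OF pq(2)] lam by (intro divide_right_mono) auto
    then have "(bend (- x) p + bend (- x) q) / lam - m \<ge> s" by (simp add: s_def)
    then have "(x * F) * ((bend (- x) p + bend (- x) q) / lam - m) \<ge> \<beta> / s * s"
      using xF s \<beta> by (intro mult_mono order.trans[OF _ xF]) auto
    then show ?thesis unfolding Hx using s by simp
  qed
  define R where "R x = (D x)\<^sup>2 * x powr (- 2 * \<beta>)" for x
  have R: "R x \<le> R y" if "a \<le> x" "x \<le> y" for x y
  proof (rule DERIV_nonneg_imp_nondecreasing[OF that(2)], intro exI conjI)
    fix z assume "x \<le> z"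
    then have z: "z \<ge> a" using that by simp
    note az = a[OF z]
    have "z * P z \<ge> 0" "z * Q z \<ge> 0" using b[OF az(4)] az by (auto intro!: mult_nonneg_nonneg)
    then have "slope_field (- z) (P z) - slope_field (- z) (Q z) = - H z * D z"
      unfolding H_def D_def by (subst slope_field_diff) auto
    then have derD: "(D has_real_derivative H z * D z) (at z)"
      unfolding D_def using derP[OF az(3)] derQ[OF az(3)] by (auto intro!: derivative_eq_intros)
    show "(R has_real_derivative 2 * (D z)\<^sup>2 * z powr (- 2 * \<beta>) / z * (z * H z - \<beta>)) (at z)"
      unfolding R_def using az
      by (auto intro!: derivative_eq_intros derD simp: field_simps power2_eq_square powr_diff)
    show "0 \<le> 2 * (D z)\<^sup>2 * z powr (- 2 * \<beta>) / z * (z * H z - \<beta>)"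
      using H[OF z] az by simp
  qed
  have Rup: "R x \<le> 9 * x powr (- (2 * \<beta> - 2))" if x: "x \<ge> a" for x
  proof -
    note ax = a[OF x]
    have "k * x \<le> 2 * x" using k ax by (intro mult_right_mono) auto
    then have "\<bar>D x\<bar> \<le> 3 * x" unfolding D_def using b[OF ax(4)] ax by linarith
    then have "(D x)\<^sup>2 \<le> (3 * x)\<^sup>2" using ax by (subst abs_le_square_iff[symmetric]) auto
    then have "R x \<le> (3 * x)\<^sup>2 * x powr (- 2 * \<beta>)" unfolding R_def by (intro mult_right_mono) auto
    also have "\<dots> = 9 * (x powr 2 * x powr (- 2 * \<beta>))" using ax by (simp add: power_mult_distrib)
    also have "x powr 2 * x powr (- 2 * \<beta>) = x powr (- (2 * \<beta> - 2))" by (simp flip: powr_add)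
    finally show ?thesis .
  qed
  have "P x = Q x" if x: "x \<ge> a" for x
  proof -
    have "((\<lambda>y. 9 * y powr (- (2 * \<beta> - 2))) \<longlongrightarrow> 9 * 0) at_top"
      using \<beta> by (intro tendsto_mult tendsto_const tendsto_neg_powr filterlim_ident) auto
    moreover have "eventually (\<lambda>y. R x \<le> 9 * y powr (- (2 * \<beta> - 2))) at_top"
      using eventually_ge_at_top[of x]
    proof eventually_elim
      case (elim y)
      show ?case using R[OF x elim] Rup[OF order.trans[OF x elim]] by (rule order.trans)
    qed
    ultimately have "R x \<le> 9 * 0" by (rule tendsto_lowerbound) simp
    then have "(D x)\<^sup>2 \<le> 0" using a[OF x] by (simp add: R_def mult_le_0_iff)
    then show ?thesis by (simp add: D_def)
  qed
  then show ?thesis unfolding eventually_at_top_linorder by blast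
qed

section \<open>Profiles as curves over the cotangent of the polar angle\<close>

text \<open>The conditions of the problem that concern the open half-line, with the boundary conditions
  stated as one-sided limits.\<close>

definition is_profile :: "real \<Rightarrow> (real \<Rightarrow> real) \<Rightarrow> bool" where
  "is_profile \<mu> r \<longleftrightarrow>
     (\<forall>y>\<mu>. r y > 0 \<and> r y - y * deriv r y > 0
        \<and> (r has_real_derivative deriv r y) (at y)
        \<and> (deriv r has_real_derivative deriv (deriv r) y) (at y)
        \<and> deriv (deriv r) y / (1 + (deriv r y)\<^sup>2)
            = m / r y - (1 + (deriv r y)\<^sup>2) / (lam * (r y - y * deriv r y)))
     \<and> (r \<longlongrightarrow> 0) (at_right \<mu>) \<and> filterlim (deriv r) at_top (at_right \<mu>)"

text \<open>\<open>Y\<close> inverts \<open>y \<mapsto> u = y / r y\<close> on the range \<open>I\<close> of this map, an initial segment of the line.\<close>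

definition cot_param :: "real \<Rightarrow> (real \<Rightarrow> real) \<Rightarrow> real set \<Rightarrow> (real \<Rightarrow> real) \<Rightarrow> bool" where
  "cot_param \<mu> r I Y \<longleftrightarrow> open I \<and> 0 \<in> I \<and> (\<forall>u\<in>I. {..u} \<subseteq> I)
     \<and> (\<forall>u\<in>I. r (Y u) > 0 \<and> Y u = u * r (Y u) \<and> u * deriv r (Y u) < 1
          \<and> ((\<lambda>u. deriv r (Y u)) has_real_derivative slope_field u (deriv r (Y u))) (at u)
          \<and> ((\<lambda>u. r (Y u)) has_real_derivative
               r (Y u) * (deriv r (Y u) / (1 - u * deriv r (Y u)))) (at u))
     \<and> filterlim (\<lambda>u. deriv r (Y u)) at_top at_bot \<and> (Y \<longlongrightarrow> \<mu>) at_bot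
     \<and> {\<mu><..} \<subseteq> Y ` I"

text \<open>The derivative of \<open>y / r\<close> is \<open>(r - y r') / r\<^sup>2 > 0\<close>. Its values form an interval that is unbounded
  below, since \<open>y \<rightarrow> \<mu> < 0\<close> and \<open>r \<rightarrow> 0\<close> from above at the left end.\<close>

lemma cot_param_exists:
  assumes \<mu>: "\<mu> < 0" and r: "is_profile \<mu> r"
  obtains I Y where "cot_param \<mu> r I Y"
proof -
  define U where "U y = y / r y" for y
  have S: "open {\<mu><..}" "is_interval {\<mu><..}" by (auto simp: is_interval_1)
  have rpos: "r y > 0" and tr: "r y - y * deriv r y > 0"
    and dr: "(r has_real_derivative deriv r y) (at y)"
    and ddr: "(deriv r has_real_derivative deriv (deriv r) y) (at y)"
    and ode: "deriv (deriv r) y / (1 + (deriv r y)\<^sup>2)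
            = m / r y - (1 + (deriv r y)\<^sup>2) / (lam * (r y - y * deriv r y))" if "y \<in> {\<mu><..}" for y
    using r that by (auto simp: is_profile_def)
  have dU: "(U has_real_derivative (r y - y * deriv r y) / (r y)\<^sup>2) (at y)" if "y \<in> {\<mu><..}" for y
    unfolding U_def using rpos[OF that]
    by (auto intro!: derivative_eq_intros dr[OF that] simp: power2_eq_square)
  have dUpos: "(r y - y * deriv r y) / (r y)\<^sup>2 > 0" if "y \<in> {\<mu><..}" for y
    using rpos[OF that] tr[OF that] by simp
  obtain Y where YU: "\<And>y. y \<in> {\<mu><..} \<Longrightarrow> Y (U y) = y"
    and dY: "\<And>y. y \<in> {\<mu><..} \<Longrightarrow>
        (Y has_real_derivative inverse ((r y - y * deriv r y) / (r y)\<^sup>2)) (at (U y))"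
    and I: "open (U ` {\<mu><..})" "is_interval (U ` {\<mu><..})" and mono: "strict_mono_on {\<mu><..} U"
    using increasing_inverse[OF S dU dUpos] by blast
  define I where "I = U ` {\<mu><..}"
  have limU: "filterlim U at_bot (at_right \<mu>)"
  proof -
    have "eventually (\<lambda>y. 0 < r y) (at_right \<mu>)"
      using eventually_at_right_less[of \<mu>] by eventually_elim (use rpos in auto)
    then have "filterlim (\<lambda>y. inverse (r y)) at_top (at_right \<mu>)"
      using r unfolding is_profile_def by (intro filterlim_inverse_at_top) auto
    then show ?thesis
      unfolding U_def divide_inverse
      by (rule filterlim_tendsto_neg_mult_at_bot[OF tendsto_ident_at \<mu>])
  qed
  have down: "{..u} \<subseteq> I" if u: "u \<in> I" for u
  proof
    fix v assume v: "v \<in> {..u}"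
    have "eventually (\<lambda>y. U y \<le> v \<and> y > \<mu>) (at_right \<mu>)"
      using limU eventually_at_right_less[of \<mu>] unfolding filterlim_at_bot by (auto intro: eventually_conj)
    then obtain y where "U y \<le> v" "y > \<mu>" using eventually_happens[of _ "at_right \<mu>"] by auto
    then have "U y \<in> I" by (simp add: I_def)
    then show "v \<in> I"
      using mem_is_interval_1_I[OF I(2)[folded I_def] _ u \<open>U y \<le> v\<close>] v by simp
  qed
  have YI: "Y u > \<mu>" "U (Y u) = u" if "u \<in> I" for u
    using that YU by (auto simp: I_def)
  have near: "eventually (\<lambda>u. u \<in> I \<and> Y u < y) at_bot" if y: "y > \<mu>" for y
  proof -
    have "U y \<in> I" using y by (simp add: I_def)
    have "u \<in> I \<and> Y u < y" if u: "u < U y" for u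
    proof
      show uI: "u \<in> I" using down[OF \<open>U y \<in> I\<close>] u by auto
      show "Y u < y"
      proof (rule ccontr)
        assume "\<not> Y u < y"
        then have "U y \<le> U (Y u)"
          using strict_mono_on_leD[OF mono, of y "Y u"] y YI[OF uI] by auto
        then show False using YI[OF uI] u by simp
      qed
    qed
    then show ?thesis unfolding eventually_at_bot_dense by blast
  qed
  have Yright: "filterlim Y (at_right \<mu>) at_bot"
    unfolding filterlim_at
  proof
    show "(Y \<longlongrightarrow> \<mu>) at_bot"
    proof (rule order_tendstoI)
      fix a assume "a < \<mu>"
      then show "eventually (\<lambda>u. a < Y u) at_bot"
        by (intro eventually_mono[OF near[of "\<mu> + 1"]]) (use \<open>a < \<mu>\<close> in \<open>auto dest: YI(1)\<close>)
    next
      fix a assume "\<mu> < a"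
      then show "eventually (\<lambda>u. Y u < a) at_bot" by (intro eventually_mono[OF near]) auto
    qed
    show "eventually (\<lambda>u. Y u \<in> {\<mu><..} \<and> Y u \<noteq> \<mu>) at_bot"
      by (intro eventually_mono[OF near[of "\<mu> + 1"]]) (auto dest: YI(1))
  qed
  have main: "r (Y u) > 0 \<and> Y u = u * r (Y u) \<and> u * deriv r (Y u) < 1
          \<and> ((\<lambda>u. deriv r (Y u)) has_real_derivative slope_field u (deriv r (Y u))) (at u)
          \<and> ((\<lambda>u. r (Y u)) has_real_derivative
               r (Y u) * (deriv r (Y u) / (1 - u * deriv r (Y u)))) (at u)" if u: "u \<in> I" for u
  proof -
    define y R p where "y = Y u" and "R = r y" and "p = deriv r y"
    have y: "y \<in> {\<mu><..}" using YI[OF u] by (simp add: y_def)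
    have R: "R > 0" using rpos[OF y] by (simp add: R_def)
    have uy: "u = y / R" using YI(2)[OF u] by (simp add: y_def R_def U_def)
    then have yu: "y = u * R" using R by simp
    have num: "r y - y * deriv r y = R * (1 - u * p)"
      unfolding R_def[symmetric] p_def[symmetric] by (subst yu) (simp add: algebra_simps)
    have z: "R * (1 - u * p) > 0" using tr[OF y] num by simp
    then have z1: "1 - u * p > 0" using R by (simp add: zero_less_mult_iff)
    have "inverse ((r y - y * deriv r y) / (r y)\<^sup>2) = R / (1 - u * p)"
      using R z1 by (subst num) (simp add: power2_eq_square flip: R_def)
    then have dYu: "(Y has_real_derivative R / (1 - u * p)) (at u)"
      using dY[OF y] YI(2)[OF u] by (simp add: y_def)
    have d1: "((\<lambda>u. deriv r (Y u)) has_real_derivative deriv (deriv r) y * (R / (1 - u * p))) (at u)"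
      using DERIV_chain2[OF _ dYu] ddr[OF y] by (simp add: y_def)
    have d2: "((\<lambda>u. r (Y u)) has_real_derivative p * (R / (1 - u * p))) (at u)"
      using DERIV_chain2[OF _ dYu] dr[OF y] by (simp add: y_def p_def)
    define q where "q = deriv (deriv r) y"
    have p2: "1 + p\<^sup>2 > 0" by (simp add: add_pos_nonneg)
    have "q / (1 + p\<^sup>2) = m / R - (1 + p\<^sup>2) / (lam * (R * (1 - u * p)))"
      using ode[OF y] unfolding num by (simp only: q_def R_def p_def)
    then have "q = (1 + p\<^sup>2) * (m / R - (1 + p\<^sup>2) / (lam * (R * (1 - u * p))))"
      using p2 by (simp add: field_simps)
    then have "q * (R / (1 - u * p)) = slope_field u p"
      unfolding slope_field_def bend_def using R z1 lam_bounds by (simp add: divide_simps) algebra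
    then show ?thesis
      using R yu z1 d1 d2 by (simp add: q_def p_def R_def y_def mult.commute)
  qed
  have "cot_param \<mu> r I Y"
    unfolding cot_param_def
  proof (intro conjI ballI)
    show "open I" using I by (simp add: I_def)
    show "0 \<in> I" unfolding I_def by (rule image_eqI[of _ _ 0]) (use \<mu> in \<open>auto simp: U_def\<close>)
    show "filterlim (\<lambda>u. deriv r (Y u)) at_top at_bot"
      using r Yright unfolding is_profile_def by (auto intro: filterlim_compose)
    show "(Y \<longlongrightarrow> \<mu>) at_bot" using Yright by (simp add: filterlim_at)
    show "{\<mu><..} \<subseteq> Y ` I" using YU by (force simp: I_def)
  qed (use main down in auto)
  then show thesis by (rule that)
qed

section \<open>Uniqueness of the profile\<close>

text \<open>The slopes agree near \<open>u = -\<infinity>\<close> by \<open>escaping_slopes_agree\<close>, hence on all of \<open>I1\<close>. Both radii then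
  satisfy the same linear equation in \<open>u\<close>, so their quotient is a constant \<open>K\<close>, and the two
  starting points \<open>\<mu> = K * \<mu>\<close> fix it. This is where the scaling freedom is removed.\<close>

lemma cot_param_agree:
  assumes \<mu>: "\<mu> < 0" and c1: "cot_param \<mu> r1 I1 Y1" and c2: "cot_param \<mu> r2 I2 Y2" and sub: "I1 \<subseteq> I2"
    and y: "y > \<mu>"
  shows "r1 y = r2 y"
proof -
  define p1 p2 where "p1 = (\<lambda>u. deriv r1 (Y1 u))" and "p2 = (\<lambda>u. deriv r2 (Y2 u))"
  have Y: "(Y1 \<longlongrightarrow> \<mu>) at_bot" "(Y2 \<longlongrightarrow> \<mu>) at_bot" "{\<mu><..} \<subseteq> Y1 ` I1"
    using c1 c2 unfolding cot_param_def by - (elim conjE, assumption)+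
  note defs = c1[unfolded cot_param_def] c2[unfolded cot_param_def]
  have down: "v \<in> I1" if "u \<in> I1" "v \<le> u" for u v using defs(1) that by auto
  have neg: "u \<in> I1" if "u \<le> 0" for u using down[of 0] defs(1) that by auto
  have d: "(p1 has_real_derivative slope_field u (p1 u)) (at u)" "u * p1 u < 1"
    "(p2 has_real_derivative slope_field u (p2 u)) (at u)" "u * p2 u < 1" if "u \<in> I1" for u
    using defs that sub by (auto simp: p1_def p2_def)
  have mirror: "((\<lambda>x. p (- x)) has_real_derivative - slope_field (- x) (p (- x))) (at x)"
    if "(p has_real_derivative slope_field (- x) (p (- x))) (at (- x))" for p x
    using that DERIV_mirror[of p] by simp
  have top: "filterlim (\<lambda>x. p (- x)) at_top at_top" if "filterlim p at_top at_bot" for p :: "real \<Rightarrow> real"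
    using that unfolding filterlim_at_bot_mirror .
  have "eventually (\<lambda>x. p1 (- x) = p2 (- x)) at_top"
  proof (rule escaping_slopes_agree[where ?x0.0 = 0])
    show "filterlim (\<lambda>x. p1 (- x)) at_top at_top" "filterlim (\<lambda>x. p2 (- x)) at_top at_top"
      using defs by (auto intro!: top simp: p1_def p2_def)
  qed (auto intro!: mirror d neg)
  then obtain b where b: "\<And>x. x \<ge> b \<Longrightarrow> p1 (- x) = p2 (- x)"
    unfolding eventually_at_top_linorder by blast
  define a where "a = - max b 0"
  have a: "a \<in> I1" "p1 a = p2 a" using b[of "max b 0"] neg[of a] by (auto simp: a_def)
  have pp: "p1 u = p2 u" if u: "u \<in> I1" for u
  proof -
    define H where "H t = slope_quotient t (p1 t) (p2 t)" for t
    have sub1: "t \<in> I1" if "t \<in> {min u a..max u a}" for t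
      using down[of "max u a" t] that u a by (auto simp: max_def split: if_splits)
    have ne: "t * p1 t \<noteq> 1" "t * p2 t \<noteq> 1" if "t \<in> {min u a..max u a}" for t
      using d[OF sub1[OF that]] by auto
    have "p1 u - p2 u = 0"
    proof (rule linear_ode_zero[where D = "\<lambda>t. p1 t - p2 t" and t = u and H = H and a = "min u a" and b = "max u a" and s = a])
      have "continuous_on {min u a..max u a} p1"
        by (rule DERIV_continuous_on, rule has_field_derivative_at_within, rule d(1), rule sub1)
      moreover have "continuous_on {min u a..max u a} p2"
        by (rule DERIV_continuous_on, rule has_field_derivative_at_within, rule d(3), rule sub1)
      ultimately show "continuous_on {min u a..max u a} H"
        unfolding H_def slope_quotient_def bend_def using ne lam_bounds by (intro continuous_intros) auto
      fix t assume t: "t \<in> {min u a..max u a}"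
      show "((\<lambda>t. p1 t - p2 t) has_real_derivative H t * (p1 t - p2 t)) (at t within {min u a..max u a})"
        unfolding H_def slope_field_diff[OF ne[OF t], symmetric]
        using d(1,3)[OF sub1[OF t]] by (blast intro: DERIV_diff has_field_derivative_at_within)
    qed (use a in auto)
    then show ?thesis by simp
  qed
  define R1 R2 where "R1 = (\<lambda>u. r1 (Y1 u))" and "R2 = (\<lambda>u. r2 (Y2 u))"
  have R: "R1 u > 0" "R2 u > 0" "Y1 u = u * R1 u" "Y2 u = u * R2 u"
    "(R1 has_real_derivative R1 u * (p1 u / (1 - u * p1 u))) (at u)"
    "(R2 has_real_derivative R2 u * (p2 u / (1 - u * p2 u))) (at u)" if "u \<in> I1" for u
    using defs that sub by (auto simp: p1_def p2_def R1_def R2_def)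
  have cv: "convex I1" using down by (auto simp: is_interval_convex_1[symmetric] is_interval_1)
  have d0: "((\<lambda>u. R1 u / R2 u) has_field_derivative 0) (at u within I1)" if u: "u \<in> I1" for u
  proof -
    have "((\<lambda>u. R1 u / R2 u) has_field_derivative 0) (at u)"
      using DERIV_divide[OF R(5)[OF u] R(6)[OF u]] R(2)[OF u] pp[OF u] by simp
    then show ?thesis by (rule has_field_derivative_at_within)
  qed
  from has_field_derivative_zero_constant[OF cv d0]
  obtain K where K: "\<And>u. u \<in> I1 \<Longrightarrow> R1 u / R2 u = K" by auto
  then have RK: "R1 u = K * R2 u" if "u \<in> I1" for u using R(2)[OF that] K[OF that] by (simp add: field_simps)
  have "eventually (\<lambda>u::real. u \<le> 0) at_bot" by (rule eventually_le_at_bot)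
  then have "eventually (\<lambda>u. Y1 u = K * Y2 u) at_bot"
  proof eventually_elim
    case (elim u)
    then have u: "u \<in> I1" by (rule neg)
    show ?case using R(3,4)[OF u] RK[OF u] by simp
  qed
  then have "((\<lambda>u. K * Y2 u) \<longlongrightarrow> \<mu>) at_bot"
    by (rule Lim_transform_eventually[OF Y(1)])
  moreover have "((\<lambda>u. K * Y2 u) \<longlongrightarrow> K * \<mu>) at_bot" using Y(2) by (rule tendsto_mult_left)
  ultimately have "\<mu> = K * \<mu>" by (intro tendsto_unique[of at_bot]) auto
  then have "K = 1" using \<mu> by simp
  obtain u where u: "u \<in> I1" "y = Y1 u" using Y(3) y by auto
  then have "Y2 u = y" using R[OF u(1)] RK[OF u(1)] \<open>K = 1\<close> by simp
  then show ?thesis using RK[OF u(1)] \<open>K = 1\<close> u by (simp add: R1_def R2_def)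
qed

text \<open>Two downward closed sets of reals are comparable, which supplies the inclusion assumed in
  \<open>cot_param_agree\<close> for one order of the two profiles.\<close>

lemma profile_unique:
  assumes \<mu>: "\<mu> < 0" and r1: "is_profile \<mu> r1" and r2: "is_profile \<mu> r2" and y: "y > \<mu>"
  shows "r1 y = r2 y"
proof -
  obtain I1 Y1 I2 Y2 where c: "cot_param \<mu> r1 I1 Y1" "cot_param \<mu> r2 I2 Y2"
    using cot_param_exists[OF \<mu> r1] cot_param_exists[OF \<mu> r2] by metis
  have "I1 \<subseteq> I2 \<or> I2 \<subseteq> I1"
  proof (rule ccontr)
    assume "\<not> ?thesis"
    then obtain u v where "u \<in> I1" "u \<notin> I2" "v \<in> I2" "v \<notin> I1" by blast
    then show False using c unfolding cot_param_def by (metis atMost_iff le_cases subsetD)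
  qed
  then show ?thesis
    using cot_param_agree[OF \<mu> c(1) c(2) _ y] cot_param_agree[OF \<mu> c(2) c(1) _ y] by auto
qed

section \<open>Construction of the profile\<close>

text \<open>Integrating \<open>dR/R = p / (1 - u p) du\<close> recovers the radius up to a factor, and \<open>Z = u R\<close> is then
  strictly increasing. It is unbounded above by \<open>slope_decay\<close>, and bounded below because
  \<open>p \<ge> - u\<close> makes the logarithmic derivative \<open>1 / (u (1 - u p))\<close> of \<open>- Z\<close> integrable at \<open>-\<infinity>\<close>.
  Its infimum is negative, so rescaling moves it to \<open>\<mu>\<close>.\<close>

lemma cot_curve_exists:
  assumes \<mu>: "\<mu> < 0"
  obtains p R where "\<And>u. (p has_real_derivative slope_field u (p u)) (at u)"
    and "\<And>u. - u \<le> p u" and "\<And>u. u * p u < 1" and "\<And>u. R u > 0"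
    and "\<And>u. (R has_real_derivative R u * (p u / (1 - u * p u))) (at u)"
    and "range (\<lambda>u. u * R u) = {\<mu><..}"
proof -
  obtain p where p: "\<And>u. (p has_real_derivative slope_field u (p u)) (at u)"
    and low: "\<And>u. - u \<le> p u" and p1: "\<And>u. u * p u < 1"
  proof (rule slope_exists)
    fix p assume "\<And>u. (p has_real_derivative slope_field u (p u)) (at u)"
      "\<And>u. - u \<le> p u" "\<And>u. u * p u < 1"
    then show thesis by (rule that)
  qed
  have p1': "1 - u * p u \<noteq> 0" for u using p1[of u] by simp
  have contp: "isCont p u" for u using p by (rule DERIV_isCont)
  have conth: "isCont (\<lambda>u. p u / (1 - u * p u)) u" for u
    by (intro continuous_intros contp p1')
  obtain G where G: "\<And>u. (G has_real_derivative p u / (1 - u * p u)) (at u)"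
    using einterval_antiderivative[of "-\<infinity>" "\<infinity>" "\<lambda>u. p u / (1 - u * p u)"]
    by (auto simp: conth has_real_derivative_iff_has_vector_derivative)
  define Z where "Z u = u * exp (G u)" for u
  have dZ: "(Z has_real_derivative exp (G u) / (1 - u * p u)) (at u)" for u
  proof -
    have "(Z has_real_derivative exp (G u) + u * (exp (G u) * (p u / (1 - u * p u)))) (at u)"
      unfolding Z_def by (auto intro!: derivative_eq_intros G)
    moreover have "exp (G u) + u * (exp (G u) * (p u / (1 - u * p u))) = exp (G u) / (1 - u * p u)"
      using p1'[of u] by (simp add: field_simps)
    ultimately show ?thesis by simp
  qed
  have Zmono: "Z u < Z v" if "u < v" for u v
    by (rule DERIV_pos_imp_increasing[OF that]) (use dZ p1 in \<open>force intro: divide_pos_pos\<close>)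
  have contZ: "continuous_on UNIV Z" using dZ by (intro DERIV_continuous_on[of UNIV]) auto
  have Ztop: "\<exists>u. z \<le> Z u" for z
  proof -
    obtain u1 M where u1: "u1 > 0" and M: "M > 0" and dec: "\<And>u. u \<ge> u1 \<Longrightarrow> - (u * p u) \<le> M"
      using slope_decay[OF p low] by blast
    \<comment> \<open>Since \<open>1 - u p \<le> 1 + M\<close>, \<open>Z\<close> grows at least like the power \<open>1 / (1 + M)\<close> of \<open>u\<close>.\<close>
    define Q where "Q u = ln (Z u) - ln u / (1 + M)" for u
    have Q: "Q u1 \<le> Q u" if "u1 \<le> u" for u
    proof (rule DERIV_nonneg_imp_nondecreasing[OF that], intro exI conjI)
      fix v assume v: "u1 \<le> v"
      have v0: "v > 0" using v u1 by simp
      have Zv: "Z v > 0" using v0 by (simp add: Z_def)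
      show "(Q has_real_derivative exp (G v) / (1 - v * p v) / Z v - 1 / v / (1 + M)) (at v)"
        unfolding Q_def using Zv v0 M by (auto intro!: derivative_eq_intros dZ)
      have "exp (G v) / (1 - v * p v) / Z v = 1 / (v * (1 - v * p v))"
        using v0 by (simp add: Z_def)
      also have "\<dots> \<ge> 1 / (v * (1 + M))"
        using dec[OF v] p1[of v] v0 M by (intro divide_left_mono mult_left_mono) auto
      finally show "0 \<le> exp (G v) / (1 - v * p v) / Z v - 1 / v / (1 + M)" by simp
    qed
    define u where "u = max u1 (exp ((1 + M) * (\<bar>z\<bar> - Q u1)))"
    have u: "u \<ge> u1" "u > 0" using u1 by (auto simp: u_def)
    have "(1 + M) * (\<bar>z\<bar> - Q u1) \<le> ln u" using u by (subst ln_ge_iff) (auto simp: u_def)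
    then have "\<bar>z\<bar> - Q u1 \<le> ln u / (1 + M)" using M by (simp add: field_simps)
    then have "\<bar>z\<bar> \<le> ln (Z u)" using Q[OF u(1)] by (simp add: Q_def)
    also have "\<dots> < Z u" using u by (intro ln_less_self) (simp add: Z_def)
    finally show ?thesis by (intro exI[of _ u]) simp
  qed
  define V where "V u = ln (- Z u) - 1 / u" for u
  have V: "V u \<le> V (- 1)" if "u \<le> - 1" for u
  proof (rule DERIV_nonneg_imp_nondecreasing[OF that], intro exI conjI)
    fix v :: real assume v: "v \<le> - 1"
    have Zv: "Z v < 0" using v by (simp add: Z_def mult_neg_pos)
    show "(V has_real_derivative exp (G v) / (1 - v * p v) / Z v + 1 / v\<^sup>2) (at v)"
      unfolding V_def using Zv v by (auto intro!: derivative_eq_intros dZ simp: power2_eq_square)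
    have "v * p v \<le> v * (- v)" using low[of v] v by (intro mult_left_mono_neg) auto
    then have "1 - v * p v \<ge> - v" using v mult_left_mono[of 1 "- v" "- v"] by simp
    then have 1: "(- v) * (1 - v * p v) \<ge> (- v) * (- v)" using v by (intro mult_left_mono) auto
    have "1 / ((- v) * (1 - v * p v)) \<le> 1 / ((- v) * (- v))"
      using 1 v p1[of v] by (intro divide_left_mono mult_pos_pos) auto
    moreover have "exp (G v) / (1 - v * p v) / Z v = - (1 / ((- v) * (1 - v * p v)))"
      using v by (simp add: Z_def)
    ultimately show "0 \<le> exp (G v) / (1 - v * p v) / Z v + 1 / v\<^sup>2" by (simp add: power2_eq_square)
  qed
  have low1: "- exp (V (- 1)) \<le> Z u" if u: "u \<le> - 1" for u
  proof -
    have "- Z u > 0" using u by (simp add: Z_def mult_neg_pos)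
    moreover have "ln (- Z u) \<le> V (- 1)" using V[OF u] u by (simp add: V_def divide_nonneg_neg) (smt (verit) divide_nonneg_neg)
    ultimately have "- Z u \<le> exp (V (- 1))" by (metis exp_le_cancel_iff exp_ln)
    then show ?thesis by simp
  qed
  have bdd: "bdd_below (range Z)"
  proof (rule bdd_belowI2)
    fix u :: real
    show "- exp (V (- 1)) \<le> Z u"
      using low1[of u] low1[of "- 1"] Zmono[of "- 1" u] by (cases "u \<le> - 1") auto
  qed
  define l where "l = Inf (range Z)"
  have l: "l < Z u" for u
    using cInf_lower[OF _ bdd, of "Z (u - 1)"] Zmono[of "u - 1" u] by (simp add: l_def)
  have "l < 0" using l[of "- 1"] by (simp add: Z_def) (smt (verit) exp_gt_zero)
  have rangeZ: "range Z = {l<..}"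
  proof
    show "range Z \<subseteq> {l<..}" using l by auto
    show "{l<..} \<subseteq> range Z"
    proof
      fix z assume "z \<in> {l<..}"
      then obtain a where a: "Z a < z" using cInf_less_iff[OF _ bdd, of z] by (auto simp: l_def)
      obtain b where b: "z \<le> Z b" using Ztop by blast
      have "a \<le> b" using Zmono[of b a] a b by linarith
      then obtain c where "Z c = z"
        using IVT'[of Z a z b] a b continuous_on_subset[OF contZ] by auto
      then show "z \<in> range Z" by blast
    qed
  qed
  define s where "s = \<mu> / l"
  have s: "s > 0" using \<mu> \<open>l < 0\<close> by (simp add: s_def divide_neg_neg)
  define R where "R u = s * exp (G u)" for u
  show thesis
  proof
    show "R u > 0" for u using s by (simp add: R_def)
    show "(R has_real_derivative R u * (p u / (1 - u * p u))) (at u)" for u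
      unfolding R_def by (auto intro!: derivative_eq_intros G)
    have "range (\<lambda>u. u * R u) = (*) s ` range Z" by (auto simp: R_def Z_def image_image mult.left_commute)
    also have "\<dots> = {s * l<..}"
    proof
      show "(*) s ` range Z \<subseteq> {s * l<..}" unfolding rangeZ using s by auto
      have "z = s * (z / s) \<and> z / s \<in> {l<..}" if "z > s * l" for z
        using s that by (simp add: field_simps)
      then show "{s * l<..} \<subseteq> (*) s ` range Z" unfolding rangeZ by blast
    qed
    also have "s * l = \<mu>" using \<open>l < 0\<close> by (simp add: s_def)
    finally show "range (\<lambda>u. u * R u) = {\<mu><..}" .
  qed (use p low p1 in auto)
qed

text \<open>With \<open>g\<close> the inverse of \<open>u \<mapsto> u * R u\<close>, the profile is \<open>R \<circ> g\<close>. Its derivative is \<open>p \<circ> g\<close>, so the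
  slope equation becomes the second-order equation; and \<open>g \<rightarrow> -\<infinity>\<close> at \<open>\<mu>\<close>, where \<open>p \<ge> - u\<close> gives the
  vertical tangent and \<open>r = y / g\<close> gives \<open>r \<rightarrow> 0\<close>.\<close>

lemma profile_exists:
  assumes \<mu>: "\<mu> < 0"
  obtains r where "is_profile \<mu> r" "continuous_on {\<mu><..} (deriv (deriv r))"
    "r \<mu> = 0" "r \<in> extensional {\<mu>..}"
proof -
  obtain p R where p: "\<And>u. (p has_real_derivative slope_field u (p u)) (at u)"
    and low: "\<And>u. - u \<le> p u" and p1: "\<And>u. u * p u < 1" and R: "\<And>u. R u > 0"
    and dR: "\<And>u. (R has_real_derivative R u * (p u / (1 - u * p u))) (at u)"
    and range: "range (\<lambda>u. u * R u) = {\<mu><..}"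
    using cot_curve_exists[OF \<mu>] by blast
  have p1': "1 - u * p u > 0" for u using p1[of u] by simp
  define Y where "Y u = u * R u" for u
  have dY: "(Y has_real_derivative R u / (1 - u * p u)) (at u)" for u
  proof -
    have "(Y has_real_derivative R u + u * (R u * (p u / (1 - u * p u)))) (at u)"
      unfolding Y_def by (auto intro!: derivative_eq_intros dR)
    moreover have "R u + u * (R u * (p u / (1 - u * p u))) = R u / (1 - u * p u)"
      using p1'[of u] by (simp add: field_simps)
    ultimately show ?thesis by simp
  qed
  have dYpos: "R u / (1 - u * p u) > 0" for u using R p1' by simp
  have iv: "open (UNIV :: real set)" "is_interval (UNIV :: real set)" by auto
  obtain g where gY: "\<And>u. g (Y u) = u"
    and dg: "\<And>u. (g has_real_derivative inverse (R u / (1 - u * p u))) (at (Y u))"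
    and mono: "strict_mono_on UNIV Y"
  proof (rule increasing_inverse[OF iv dY dYpos])
    fix g assume g: "\<And>u. u \<in> UNIV \<Longrightarrow> g (Y u) = u"
      "\<And>u. u \<in> UNIV \<Longrightarrow> (g has_real_derivative inverse (R u / (1 - u * p u))) (at (Y u))"
      "strict_mono Y"
    show thesis by (rule that[OF g(1)[OF UNIV_I] g(2)[OF UNIV_I] g(3)])
  qed
  have YR: "range Y = {\<mu><..}" using range by (simp add: Y_def[abs_def])
  have Yg: "Y (g y) = y" if "y > \<mu>" for y
  proof -
    have "y \<in> range Y" using that YR by simp
    then show ?thesis using gY by auto
  qed
  have dg': "(g has_real_derivative (1 - g y * p (g y)) / R (g y)) (at y)" if "y > \<mu>" for y
    using dg[of "g y"] Yg[OF that] by simp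
  define r where "r y = (if \<mu> < y then R (g y) else if y = \<mu> then 0 else undefined)" for y
  define r2 where "r2 y = slope_field (g y) (p (g y)) * ((1 - g y * p (g y)) / R (g y))" for y
  have dr: "(r has_real_derivative p (g y)) (at y)" if y: "y > \<mu>" for y
  proof -
    have "((\<lambda>y. R (g y)) has_real_derivative
        R (g y) * (p (g y) / (1 - g y * p (g y))) * ((1 - g y * p (g y)) / R (g y))) (at y)"
      by (rule DERIV_chain2[OF dR dg'[OF y]])
    then have "((\<lambda>y. R (g y)) has_real_derivative p (g y)) (at y)"
      using R[of "g y"] p1'[of "g y"] by simp
    then show ?thesis
      by (rule has_field_derivative_transform_within_open[of _ _ _ "{\<mu><..}"]) (use y in \<open>auto simp: r_def\<close>)
  qed
  have r1: "deriv r y = p (g y)" if "y > \<mu>" for y using dr[OF that] by (rule DERIV_imp_deriv)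
  have ddr: "(deriv r has_real_derivative r2 y) (at y)" if y: "y > \<mu>" for y
  proof -
    have "((\<lambda>y. p (g y)) has_real_derivative r2 y) (at y)"
      unfolding r2_def by (rule DERIV_chain2[OF p dg'[OF y]])
    then show ?thesis
      by (rule has_field_derivative_transform_within_open[of _ _ _ "{\<mu><..}"]) (use y in \<open>auto simp: r1\<close>)
  qed
  have r2: "deriv (deriv r) y = r2 y" if "y > \<mu>" for y using ddr[OF that] by (rule DERIV_imp_deriv)
  have contg: "continuous_on {\<mu><..} g"
    by (rule DERIV_continuous_on, rule has_field_derivative_at_within, rule dg') simp
  have contp: "continuous_on UNIV p" and contR: "continuous_on UNIV R"
    using p dR by (auto intro!: DERIV_continuous_on[of UNIV])
  have cp: "continuous_on {\<mu><..} (\<lambda>y. p (g y))" and cR: "continuous_on {\<mu><..} (\<lambda>y. R (g y))"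
    by (rule continuous_on_compose2[OF contp contg], simp)
       (rule continuous_on_compose2[OF contR contg], simp)
  have "continuous_on {\<mu><..} r2"
    unfolding r2_def slope_field_def bend_def
    by (intro continuous_intros cp cR contg) (use p1' R lam_bounds in \<open>auto simp: less_imp_neq[symmetric]\<close>)
  then have C2: "continuous_on {\<mu><..} (deriv (deriv r))"
    using r2 by (subst continuous_on_cong[OF refl, of _ _ r2]) auto
  have limg: "filterlim g at_bot (at_right \<mu>)"
    unfolding filterlim_at_bot
  proof
    fix b
    have "Y b > \<mu>" using YR by auto
    then have "eventually (\<lambda>y. y < Y b \<and> y > \<mu>) (at_right \<mu>)"
      by (intro eventually_conj eventually_at_right_less) (auto simp: eventually_at_right)
    then show "eventually (\<lambda>y. g y \<le> b) (at_right \<mu>)"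
    proof eventually_elim
      case (elim y)
      show ?case
      proof (rule ccontr)
        assume "\<not> g y \<le> b"
        then have "Y b < Y (g y)" using mono by (simp add: strict_mono_on_def)
        then show False using Yg[of y] elim by simp
      qed
    qed
  qed
  have near: "eventually (\<lambda>y. y > \<mu>) (at_right \<mu>)" by (rule eventually_at_right_less)
  have "filterlim (\<lambda>y. - g y) at_top (at_right \<mu>)"
    using limg by (simp add: filterlim_uminus_at_bot)
  then have "filterlim (\<lambda>y. p (g y)) at_top (at_right \<mu>)"
    by (rule filterlim_at_top_mono) (use low in simp)
  then have limr1: "filterlim (deriv r) at_top (at_right \<mu>)"
    by (rule filterlim_mono_eventually) (use near in \<open>auto elim!: eventually_mono simp: r1\<close>)
  have "((\<lambda>y. y / g y) \<longlongrightarrow> 0) (at_right \<mu>)"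
    by (rule tendsto_divide_0[OF tendsto_ident_at filterlim_at_bot_imp_at_infinity[OF limg]])
  moreover have "eventually (\<lambda>y. y / g y = r y) (at_right \<mu>)"
  proof -
    have "eventually (\<lambda>y. g y \<le> - 1) (at_right \<mu>)" using limg unfolding filterlim_at_bot by blast
    then show ?thesis
      using near
    proof eventually_elim
      case (elim y)
      then have "y = g y * R (g y)" using Yg[of y] by (simp add: Y_def)
      then show ?case using elim by (simp add: r_def field_simps)
    qed
  qed
  ultimately have limr: "(r \<longlongrightarrow> 0) (at_right \<mu>)" by (rule Lim_transform_eventually)
  have "is_profile \<mu> r"
    unfolding is_profile_def
  proof (intro conjI allI impI)
    fix y assume y: "\<mu> < y"
    define u where "u = g y"
    have yu: "y = u * R u" using Yg[OF y] by (simp add: u_def Y_def)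
    have ry: "r y = R u" using y by (simp add: r_def u_def)
    have num: "r y - y * deriv r y = R u * (1 - u * p u)"
      unfolding ry r1[OF y] u_def[symmetric] by (subst yu) (simp add: algebra_simps)
    show "r y > 0" using ry R by simp
    show "r y - y * deriv r y > 0" unfolding num using R p1' by simp
    show "(r has_real_derivative deriv r y) (at y)" using dr[OF y] r1[OF y] by simp
    show "(deriv r has_real_derivative deriv (deriv r) y) (at y)" using ddr[OF y] r2[OF y] by simp
    have p2: "1 + (p u)\<^sup>2 \<noteq> 0" by (smt (verit) zero_le_power2)
    have z: "1 - u * p u \<noteq> 0" "R u \<noteq> 0" "lam \<noteq> 0" using p1'[of u] R[of u] lam_bounds by auto
    have "deriv (deriv r) y / (1 + (deriv r y)\<^sup>2)
        = slope_field u (p u) * ((1 - u * p u) / R u) / (1 + (p u)\<^sup>2)"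
      by (simp add: r1[OF y] r2[OF y] r2_def u_def)
    also have "\<dots> = m / R u - (1 + (p u)\<^sup>2) / (lam * (R u * (1 - u * p u)))"
    proof -
      have "(A / z * (m - A / z / lam)) * (z / q) / A = m / q - A / (lam * (q * z))"
        if "A \<noteq> 0" "z \<noteq> 0" "q \<noteq> 0" for A z q :: real
        using that \<open>lam \<noteq> 0\<close> by (simp add: field_simps)
      then show ?thesis unfolding slope_field_def bend_def using p2 z by blast
    qed
    finally show "deriv (deriv r) y / (1 + (deriv r y)\<^sup>2)
        = m / r y - (1 + (deriv r y)\<^sup>2) / (lam * (r y - y * deriv r y))"
      unfolding num unfolding ry r1[OF y] u_def[symmetric] .
  qed (use limr limr1 in auto)
  then show thesis using that[of r] C2 by (auto simp: r_def extensional_def)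
qed

end

theorem theorem1p1:
  fixes n :: nat and lam \<mu> :: real
  assumes "n \<ge> 2" and "1 / real n < lam" and "lam < 1 / (real n - 1)" and "\<mu> < 0"
  shows "\<exists>!r. r \<in> extensional {\<mu>..}
           \<and> C2_on r {\<mu><..} \<and> continuous_on {\<mu>..} r
           \<and> profile_solution n lam \<mu> r
           \<and> (\<forall>y>\<mu>. r y - y * deriv r y > 0)"
proof -
  interpret expander "real n - 1" lam
    using assms by unfold_locales auto
  have right: "(at \<mu> within {\<mu>..}) = at_right \<mu>" by (simp add: at_within_Ici_at_right)
  have profileI: "is_profile \<mu> r" if "C2_on r {\<mu><..}" "continuous_on {\<mu>..} r"
    "profile_solution n lam \<mu> r" "\<forall>y>\<mu>. r y - y * deriv r y > 0" for r
  proof -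
    have "(r \<longlongrightarrow> r \<mu>) (at_right \<mu>)"
      using that(2) unfolding continuous_on_def right[symmetric] by simp
    then show ?thesis
      using that unfolding is_profile_def C2_on_def profile_solution_def
      by (auto simp: DERIV_deriv_iff_real_differentiable)
  qed
  show ?thesis
  proof (rule ex_ex1I)
    obtain r where r: "is_profile \<mu> r" "continuous_on {\<mu><..} (deriv (deriv r))"
      "r \<mu> = 0" "r \<in> extensional {\<mu>..}"
      using profile_exists[OF assms(4)] by blast
    have "C2_on r {\<mu><..}"
      using r unfolding C2_on_def is_profile_def
      by (auto simp: real_differentiable_def)
    moreover have "continuous_on {\<mu>..} r"
      unfolding continuous_on_eq_continuous_within
    proof
      fix y assume "y \<in> {\<mu>..}"
      show "continuous (at y within {\<mu>..}) r"
      proof (cases "y = \<mu>")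
        case True
        then show ?thesis using r unfolding continuous_within is_profile_def by (simp add: right)
      next
        case False
        then have "(r has_real_derivative deriv r y) (at y)"
          using r \<open>y \<in> {\<mu>..}\<close> unfolding is_profile_def by auto
        then show ?thesis by (rule continuous_at_imp_continuous_at_within[OF DERIV_isCont])
      qed
    qed
    moreover have "profile_solution n lam \<mu> r" "\<forall>y>\<mu>. r y - y * deriv r y > 0"
      using r unfolding profile_solution_def is_profile_def by auto
    ultimately show "\<exists>r. r \<in> extensional {\<mu>..}
           \<and> C2_on r {\<mu><..} \<and> continuous_on {\<mu>..} r
           \<and> profile_solution n lam \<mu> r
           \<and> (\<forall>y>\<mu>. r y - y * deriv r y > 0)" using r(4) by blast
  next
    fix r s
    assume r: "r \<in> extensional {\<mu>..} \<and> C2_on r {\<mu><..} \<and> continuous_on {\<mu>..} r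
           \<and> profile_solution n lam \<mu> r \<and> (\<forall>y>\<mu>. r y - y * deriv r y > 0)"
      and s: "s \<in> extensional {\<mu>..} \<and> C2_on s {\<mu><..} \<and> continuous_on {\<mu>..} s
           \<and> profile_solution n lam \<mu> s \<and> (\<forall>y>\<mu>. s y - y * deriv s y > 0)"
    show "r = s"
    proof (rule extensionalityI[of _ "{\<mu>..}"])
      fix y assume y: "y \<in> {\<mu>..}"
      show "r y = s y"
      proof (cases "y = \<mu>")
        case True
        then show ?thesis using r s by (simp add: profile_solution_def)
      next
        case False
        then show ?thesis
          using profile_unique[OF assms(4) profileI profileI, of r s y] r s y by auto
      qed
    qed (use r s in auto)
  qed
qed

end
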